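(* Let $w\in S_n$ with reduced expression $\underline w$. The cones $\mathcal C_{\underline w}$ and $\mathcal S_{\underline w}$ are unimodularly equivalent, the lattice-preserving linear map being given by the duality of faces and vertices of the pseudoline arrangement, i.e. by $\Psi_{\underline w}$: $\Psi_{\underline w}$ is represented by a matrix in $GL_{\ell(w)+n-1}(\mathbb Z)$ and its transpose maps $\mathcal C_{\underline w}$ bijectively onto $\mathcal S_{\underline w}$. Moreover, this linear map restricts to linear bijections between the polytopes $\pi^{-1}(\lambda)\cap\mathcal C_{\underline w}\cong\tau_{\underline w}^{-1}(\lambda)\cap\mathcal S_{\underline w}$ for every $\lambda\in\mathbb R^{n-1}$, and (in the same way, using the restriction of $\Psi_{\underline w}$ to $\mathbb R^{\ell(w)}$) induces a unimodular equivalence of the cones $S_{\underline w}\cong C_{\underline w}$.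
   Context: Pseudoline arrangement. Let $\underline w=s_{i_1}\cdots s_{i_\ell}$, $\ell=\ell(w)$. $\operatorname{pa}(\underline w)$ consists of $n$ lines $l_1,\dots,l_n$ drawn from left to right, $l_i$ starting at height $i$ (from the bottom); the $j$-th crossing from the left interchanges the lines at heights $i_j,i_j+1$ and is said to be at level $i_j$. If it is the crossing of $l_k,l_m$ ($k<m$) it is denoted $v_{(k,m)}$. The right end of $l_i$ is the vertex $L_i$, at height $h(i)$. The strip at level $r\in[n-1]$ (between heights $r$ and $r+1$) is cut by the crossings at level $r$ into faces: $F_r$, unbounded to the left, and for each crossing at level $r$ (the $j$-th, $=v_{(k,m)}$) the face $F_{i_j}=F_{(k,m)}$ bounded to the left by it. Let $J(i)=\{j\in[\ell]\mid s_{i_j}=s_i\}=\{j_1<\dots<j_{n_i}\}$. GP-paths. For $i\in[n-1]$ orient $l_1,\dots,l_i$ from right to left and $l_{i+1},\dots,l_n$ from left to right. A directed path along the lines is rigorous if it never goes straight along a line $l_a$ through a crossing with $l_b$ where either $a<b$ and both are oriented to the left, or $a>b$ and both are oriented to the right. A GP-path is a rigorous path from some $L_p$ to some $L_q$ with $p\le i<q$, $h(i+1)\le h(p)\le h(i)$, $h(i+1)\le h(q)\le h(i)$. $\mathcal P_{\underline w}$ is the set of all GP-paths for all $i$. GP-cones. Let $\mathbb R^{\ell+n-1}$ have basis $c_{(k,m)}=c_{i_j}$ (crossings) and $c_1,\dots,c_{n-1}$. If $\mathbf p=L_{j_0}\to v_{(j_0,j_1)}\to v_{(j_1,j_2)}\to\dots\to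 v_{(j_k,j_{k+1})}\to L_{j_{k+1}}$ lists the crossings where $\mathbf p$ changes lines, put $c_{\mathbf p}=\sum_{s=0}^kc_{(j_s,j_{s+1})}$ with $c_{(a,b)}=-c_{(b,a)}$ for $a>b$. Put $c_{[i:0]}=c_i$ and, for $1\le k\le n_i$, $c_{[i:k]}=c_i-c_{i_{j_k}}-2\sum_{j\in J(i),j>j_k}c_{i_j}+\sum_{l\in J(i-1)\cup J(i+1),l>j_k}c_{i_l}$. Then $C_{\underline w}=\{x\in\mathbb R^\ell\mid c_{\mathbf p}^t x\ge0\ \forall\mathbf p\in\mathcal P_{\underline w}\}$ and $\mathcal C_{\underline w}=\{x\in\mathbb R^{\ell+n-1}\mid c_{\mathbf p}^tx\ge0\ \forall\mathbf p,\ c_{[i:k]}^tx\ge0\ \forall i\in[n-1],0\le k\le n_i\}$. $\pi:\mathbb R^{\ell+n-1}\to\mathbb R^{n-1}$ is $\pi(x)=(c_i^tx)_i$. Area cones. Let another copy of $\mathbb R^{\ell+n-1}$ have basis $e_F$, $F$ a face. For $\mathbf p\in\mathcal P_{\underline w}$ put $e_{\mathbf p}=-\sum_Fe_F$, sum over the faces in the region enclosed by $\mathbf p$ (to its left). Put $e_{[i:k]}=-e_{F_i}-\sum_{j\in J(i),j\le j_k}e_{F_{i_j}}$ for $0\le k\le n_i$ ($e_{[i:0]}=-e_{F_i}$). Then $S_{\underline w}=\{x\in\mathbb R^\ell\mid e_{\mathbf p}^tx\ge0\ \forall\mathbf p\}$ (coordinates: faces bounded to the left) and $\mathcal S_{\underline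 w}=\{x\in\mathbb R^{\ell+n-1}\mid e_{\mathbf p}^tx\ge0\ \forall\mathbf p,\ e_{[i:k]}^tx\ge0\ \forall i\in[n-1],0\le k\le n_i\}$. $\tau_{\underline w}(x)=(e_{[i:n_i]}^tx)_{i=1,\dots,n-1}$. The map $\Psi_{\underline w}$. It is the linear map from the space with basis $e_F$ to the space with basis $c_{(k,m)},c_i$ given by $\Psi_{\underline w}(-e_{F_{i_{j_k}}})=c_{i_{j_k}}+c_{i_{j_{k+1}}}-\sum_{j\in J(i-1)\cup J(i+1),\,j_k<j<j_{k+1}}c_{i_j}$ (for $k=n_i$ the term $c_{i_{j_{k+1}}}$ is omitted and the sum is over $j>j_{n_i}$) and $\Psi_{\underline w}(-e_{F_i})=c_{[i:1]}$ (with $c_{[i:1]}:=c_i$ if $n_i=0$). Its restriction to $\mathbb R^\ell$ is the restriction to the span of the $e_F$ with $F$ bounded to the left, with image in the span of the $c_{(k,m)}$. Two cones (polytopes) in $\mathbb R^d$ are unimodularly equivalent if one is the image of the other under a map $x\mapsto xM+v$ with $M\in GL_d(\mathbb Z)$, $v\in\mathbb Z^d$. *)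

theory Defs
  imports "Jordan_Normal_Form.Matrix" "HOL-Combinatorics.Permutations"
begin

text \<open>Conventions. An expression \<open>s\<^bsub>i1\<^esub> \<dots> s\<^bsub>il\<^esub>\<close> of an element of the symmetric group on \<open>{1..n}\<close> is
  the list of letters \<open>ws = [i1, \<dots>, il]\<close>. Lines, heights and levels are numbered from 1,
  crossings are numbered from 0: crossing \<open>j < length ws\<close> is at level \<open>ws ! j\<close>.
  Hence the crossings cut the arrangement into vertical slabs \<open>0, \<dots>, length ws\<close>,
  and crossing \<open>j\<close> separates slab \<open>j\<close> (left) from slab \<open>Suc j\<close> (right).\<close>


section \<open>Reduced expressions\<close>

definition simple_refl :: "nat \<Rightarrow> nat \<Rightarrow> nat" where
  "simple_refl i = Transposition.transpose i (Suc i)"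

definition word_perm :: "nat list \<Rightarrow> nat \<Rightarrow> nat" where
  "word_perm ws = foldr (\<lambda>i f. simple_refl i \<circ> f) ws id"

definition is_expression :: "nat \<Rightarrow> (nat \<Rightarrow> nat) \<Rightarrow> nat list \<Rightarrow> bool" where
  "is_expression n w ws \<longleftrightarrow> set ws \<subseteq> {1..n - 1} \<and> word_perm ws = w"

definition perm_length :: "nat \<Rightarrow> (nat \<Rightarrow> nat) \<Rightarrow> nat" where
  "perm_length n w = (LEAST l. \<exists>ws. is_expression n w ws \<and> length ws = l)"

definition reduced_expression :: "nat \<Rightarrow> (nat \<Rightarrow> nat) \<Rightarrow> nat list \<Rightarrow> bool" where
  "reduced_expression n w ws \<longleftrightarrow> is_expression n w ws \<and> length ws = perm_length n w"


section \<open>The pseudoline arrangement\<close>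

text \<open>\<open>line_height ws t a\<close> is the height of line \<open>a\<close> in slab \<open>t\<close>.\<close>

primrec line_height :: "nat list \<Rightarrow> nat \<Rightarrow> nat \<Rightarrow> nat" where
  "line_height ws 0 a = a"
| "line_height ws (Suc t) a = simple_refl (ws ! t) (line_height ws t a)"

definition end_height :: "nat list \<Rightarrow> nat \<Rightarrow> nat" where
  "end_height ws a = line_height ws (length ws) a"

definition lines_cross_at :: "nat list \<Rightarrow> nat \<Rightarrow> nat \<Rightarrow> nat \<Rightarrow> bool" where
  "lines_cross_at ws j a b \<longleftrightarrow>
     j < length ws \<and> {line_height ws j a, line_height ws j b} = {ws ! j, Suc (ws ! j)}"

definition level_set :: "nat list \<Rightarrow> nat \<Rightarrow> nat set" where
  "level_set ws i = {j. j < length ws \<and> ws ! j = i}"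

definition level_list :: "nat list \<Rightarrow> nat \<Rightarrow> nat list" where
  "level_list ws i = sorted_list_of_set (level_set ws i)"

definition level_count :: "nat list \<Rightarrow> nat \<Rightarrow> nat" where
  "level_count ws i = card (level_set ws i)"


section \<open>GP-paths\<close>

text \<open>A directed path along the lines is recorded as the list of all pieces \<open>(a, t)\<close> it runs
  through, where \<open>(a, t)\<close> is the part of line \<open>a\<close> inside slab \<open>t\<close>. For the orientation with
  index \<open>i\<close>, line \<open>a\<close> is directed to the left iff \<open>a \<le> i\<close>. The crossing that is reached at
  the end of the piece \<open>(a, s)\<close> is \<open>next_crossing i (a, s)\<close>; the left end of the arrangement
  (\<open>s = 0\<close> and \<open>a \<le> i\<close>) and the vertices \<open>L\<^sub>a\<close> (\<open>s = length ws\<close> and \<open>a > i\<close>) cannot be left.\<close>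

definition next_crossing :: "nat \<Rightarrow> nat \<times> nat \<Rightarrow> nat" where
  "next_crossing i x = (if fst x \<le> i then snd x - 1 else snd x)"

definition directed_step :: "nat list \<Rightarrow> nat \<Rightarrow> nat \<times> nat \<Rightarrow> nat \<times> nat \<Rightarrow> bool" where
  "directed_step ws i x y \<longleftrightarrow>
     (case x of (a, s) \<Rightarrow> case y of (b, t) \<Rightarrow>
       \<exists>j<length ws.
         s = (if a \<le> i then Suc j else j) \<and>
         t = (if b \<le> i then j else Suc j) \<and>
         (a = b \<or> lines_cross_at ws j a b))"

definition rigorous_step :: "nat list \<Rightarrow> nat \<Rightarrow> nat \<times> nat \<Rightarrow> nat \<times> nat \<Rightarrow> bool" where
  "rigorous_step ws i x y \<longleftrightarrow>
     directed_step ws i x y \<and>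
     (fst x = fst y \<longrightarrow>
       \<not> (\<exists>b. lines_cross_at ws (next_crossing i x) (fst x) b \<and>
             (fst x < b \<and> fst x \<le> i \<and> b \<le> i \<or> fst x > b \<and> fst x > i \<and> b > i)))"

text \<open>A GP-path is recorded together with the index \<open>i\<close> of its orientation.\<close>

definition gp_paths :: "nat \<Rightarrow> nat list \<Rightarrow> (nat \<times> (nat \<times> nat) list) set" where
  "gp_paths n ws = {(i, P). i \<in> {1..n - 1} \<and> P \<noteq> [] \<and> successively (rigorous_step ws i) P \<and>
     (\<exists>p\<in>{1..i}. \<exists>q\<in>{i<..n}.
        hd P = (p, length ws) \<and> last P = (q, length ws) \<and>
        end_height ws (Suc i) \<le> end_height ws p \<and> end_height ws p \<le> end_height ws i \<and>
        end_height ws (Suc i) \<le> end_height ws q \<and> end_height ws q \<le> end_height ws i)}"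


section \<open>GP-cones\<close>

text \<open>The coordinates of \<open>\<real>\<^bsup>l + n - 1\<^esup>\<close>, where \<open>l = length ws\<close>, are ordered as follows: coordinate
  \<open>j < l\<close> belongs to crossing \<open>j\<close> (respectively to the face bounded to the left by it), and
  coordinate \<open>l + i - 1\<close> belongs to \<open>c\<^sub>i\<close> (respectively to the face \<open>F\<^sub>i\<close> unbounded to the left), for
  \<open>i \<in> {1..n - 1}\<close>. The subspace \<open>\<real>\<^bsup>l\<^esup>\<close> consists of the first \<open>l\<close> coordinates; vectors which occur
  in both spaces have the dimension \<open>d\<close> as a parameter.\<close>

definition full_dim :: "nat \<Rightarrow> nat list \<Rightarrow> nat" where
  "full_dim n ws = length ws + (n - 1)"

definition level_coord :: "nat list \<Rightarrow> nat \<Rightarrow> nat" where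
  "level_coord ws i = length ws + (i - 1)"

text \<open>A change of lines from \<open>a\<close> to \<open>b\<close> at a crossing contributes \<open>c\<^bsub>(a,b)\<^esub>\<close>, which is plus or
  minus the basis vector of this crossing.\<close>

definition c_path :: "nat \<Rightarrow> nat \<Rightarrow> (nat \<times> nat) list \<Rightarrow> real vec" where
  "c_path d i P = vec d (\<lambda>m.
     \<Sum>(x, y)\<leftarrow>zip P (tl P).
       if fst x = fst y then 0
       else (if fst x < fst y then 1 else - 1) * unit_vec d (next_crossing i x) $ m)"

definition c_ineq :: "nat \<Rightarrow> nat list \<Rightarrow> nat \<Rightarrow> nat \<Rightarrow> real vec" where
  "c_ineq n ws i k =
     (let d = full_dim n ws; jk = level_list ws i ! (k - 1) in
      if k = 0 then unit_vec d (level_coord ws i)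
      else vec d (\<lambda>m.
        unit_vec d (level_coord ws i) $ m - unit_vec d jk $ m
        - 2 * (\<Sum>j\<in>{j \<in> level_set ws i. jk < j}. unit_vec d j $ m)
        + (\<Sum>j\<in>{j \<in> level_set ws (i - 1) \<union> level_set ws (i + 1). jk < j}. unit_vec d j $ m)))"

definition gp_cone :: "nat \<Rightarrow> nat list \<Rightarrow> real vec set" where
  "gp_cone n ws = {x \<in> carrier_vec (length ws).
     \<forall>(i, P)\<in>gp_paths n ws. 0 \<le> c_path (length ws) i P \<bullet> x}"

definition weighted_gp_cone :: "nat \<Rightarrow> nat list \<Rightarrow> real vec set" where
  "weighted_gp_cone n ws = {x \<in> carrier_vec (full_dim n ws).
     (\<forall>(i, P)\<in>gp_paths n ws. 0 \<le> c_path (full_dim n ws) i P \<bullet> x) \<and>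
     (\<forall>i\<in>{1..n - 1}. \<forall>k\<le>level_count ws i. 0 \<le> c_ineq n ws i k \<bullet> x)}"

definition gp_weight :: "nat \<Rightarrow> nat list \<Rightarrow> real vec \<Rightarrow> real vec" where
  "gp_weight n ws x =
     vec (n - 1) (\<lambda>r. unit_vec (full_dim n ws) (level_coord ws (Suc r)) \<bullet> x)"


section \<open>Area cones\<close>

text \<open>Every face is represented by its strip and by the leftmost slab it meets.\<close>

definition face_strip :: "nat list \<Rightarrow> nat \<Rightarrow> nat" where
  "face_strip ws f = (if f < length ws then ws ! f else Suc (f - length ws))"

definition face_slab :: "nat list \<Rightarrow> nat \<Rightarrow> nat" where
  "face_slab ws f = (if f < length ws then Suc f else 0)"

text \<open>A GP-path from \<open>L\<^sub>p\<close> to \<open>L\<^sub>q\<close> becomes a closed curve by adding the vertical segment from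
  \<open>L\<^sub>q\<close> to \<open>L\<^sub>p\<close> at the right end of the arrangement. The winding number of this curve around a
  point in slab \<open>t\<close> between heights \<open>r\<close> and \<open>r + 1\<close> is computed with the vertical ray going up
  from the point (which misses the added segment): every piece above the point counts
  \<open>1\<close> if it is directed to the left and \<open>- 1\<close> if it is directed to the right. The enclosed
  region to the left of the path is where the curve winds counterclockwise.\<close>

definition path_winding :: "nat list \<Rightarrow> nat \<Rightarrow> (nat \<times> nat) list \<Rightarrow> nat \<Rightarrow> nat \<Rightarrow> int" where
  "path_winding ws i P r t =
     (\<Sum>(a, s)\<leftarrow>P. if s = t \<and> r < line_height ws t a then (if a \<le> i then 1 else - 1) else 0)"

definition enclosed_faces :: "nat \<Rightarrow> nat list \<Rightarrow> nat \<Rightarrow> (nat \<times> nat) list \<Rightarrow> nat set" where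
  "enclosed_faces n ws i P =
     {f. f < full_dim n ws \<and> path_winding ws i P (face_strip ws f) (face_slab ws f) > 0}"

text \<open>No GP-path encloses a face that is unbounded to the left, so nothing is lost for
  \<open>d = length ws\<close>.\<close>

definition e_path :: "nat \<Rightarrow> nat \<Rightarrow> nat list \<Rightarrow> nat \<Rightarrow> (nat \<times> nat) list \<Rightarrow> real vec" where
  "e_path d n ws i P = vec d (\<lambda>m. - (\<Sum>f\<in>enclosed_faces n ws i P. unit_vec d f $ m))"

definition e_ineq :: "nat \<Rightarrow> nat list \<Rightarrow> nat \<Rightarrow> nat \<Rightarrow> real vec" where
  "e_ineq n ws i k =
     (let d = full_dim n ws; jk = level_list ws i ! (k - 1) in
      if k = 0 then - unit_vec d (level_coord ws i)
      else vec d (\<lambda>m. - unit_vec d (level_coord ws i) $ m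
                      - (\<Sum>j\<in>{j \<in> level_set ws i. j \<le> jk}. unit_vec d j $ m)))"

definition area_cone :: "nat \<Rightarrow> nat list \<Rightarrow> real vec set" where
  "area_cone n ws = {x \<in> carrier_vec (length ws).
     \<forall>(i, P)\<in>gp_paths n ws. 0 \<le> e_path (length ws) n ws i P \<bullet> x}"

definition weighted_area_cone :: "nat \<Rightarrow> nat list \<Rightarrow> real vec set" where
  "weighted_area_cone n ws = {x \<in> carrier_vec (full_dim n ws).
     (\<forall>(i, P)\<in>gp_paths n ws. 0 \<le> e_path (full_dim n ws) n ws i P \<bullet> x) \<and>
     (\<forall>i\<in>{1..n - 1}. \<forall>k\<le>level_count ws i. 0 \<le> e_ineq n ws i k \<bullet> x)}"

definition area_weight :: "nat \<Rightarrow> nat list \<Rightarrow> real vec \<Rightarrow> real vec" where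
  "area_weight n ws x =
     vec (n - 1) (\<lambda>r. e_ineq n ws (Suc r) (level_count ws (Suc r)) \<bullet> x)"


section \<open>The duality map\<close>

text \<open>The next crossing at the same level, or \<open>length ws\<close> if there is none.\<close>

definition next_at_level :: "nat list \<Rightarrow> nat \<Rightarrow> nat" where
  "next_at_level ws j = (LEAST j'. j < j' \<and> (j' = length ws \<or> ws ! j' = ws ! j))"

text \<open>\<open>psi_neg_face n ws f\<close> is the image of \<open>- e\<^sub>F\<close> for the face \<open>F\<close> with coordinate \<open>f\<close>.\<close>

definition psi_neg_face :: "nat \<Rightarrow> nat list \<Rightarrow> nat \<Rightarrow> real vec" where
  "psi_neg_face n ws f =
     (let d = full_dim n ws in
      if f < length ws then
        (let i = ws ! f; f' = next_at_level ws f in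
         vec d (\<lambda>m. unit_vec d f $ m
           + (if f' < length ws then unit_vec d f' $ m else 0)
           - (\<Sum>j\<in>{j \<in> level_set ws (i - 1) \<union> level_set ws (i + 1). f < j \<and> j < f'}.
                unit_vec d j $ m)))
      else
        (let i = face_strip ws f in
         c_ineq n ws i (if level_count ws i = 0 then 0 else 1)))"

definition Psi :: "nat \<Rightarrow> nat list \<Rightarrow> real vec \<Rightarrow> real vec" where
  "Psi n ws x = vec (full_dim n ws) (\<lambda>m.
     \<Sum>f<full_dim n ws. x $ f * (- psi_neg_face n ws f) $ m)"


section \<open>Unimodular equivalence\<close>

definition GL_int :: "nat \<Rightarrow> int mat set" where
  "GL_int d = {M \<in> carrier_mat d d. invertible_mat M}"

abbreviation real_mat :: "int mat \<Rightarrow> real mat" where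
  "real_mat M \<equiv> map_mat real_of_int M"

text \<open>The row vector \<open>x M\<close> is written as \<open>M\<^sup>T *\<^sub>v x\<close>.\<close>

definition unimodularly_equivalent :: "nat \<Rightarrow> real vec set \<Rightarrow> real vec set \<Rightarrow> bool" where
  "unimodularly_equivalent d A B \<longleftrightarrow>
     (\<exists>M\<in>GL_int d. \<exists>v\<in>carrier_vec d.
        B = (\<lambda>x. transpose_mat (real_mat M) *\<^sub>v x + map_vec real_of_int v) ` A)"

end

theory Submission
  imports Defs "Jordan_Normal_Form.Determinant"
begin

text \<open>The transpose of \<open>\<Psi>\<close> turns the functional \<open>v\<close> on the area side into the functional \<open>\<Psi> v\<close> on the
  GP side. So the theorem says that \<open>\<Psi>\<close> is invertible over the integers and carries the
  inequalities of the area cones to those of the GP-cones: \<open>\<Psi> e\<^sub>p = c\<^sub>p\<close> for every GP-path \<open>p\<close>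
  (\<open>Psi_e_path\<close>), and \<open>\<Psi> e\<^bsub>[i:k]\<^esub> = c\<^bsub>[i:k+1]\<^esub>\<close>, where the last index \<open>k = n\<^sub>i\<close> goes to \<open>k = 0\<close>
  (\<open>Psi_e_ineq\<close>). The latter is a telescoping sum along a strip; since \<open>k = n\<^sub>i\<close> defines the weight
  on the area side and \<open>k = 0\<close> the weight on the GP side, it also matches the fibres.

  The geometric part is \<open>\<Psi> e\<^sub>p = c\<^sub>p\<close>. Close \<open>p\<close> along the right end of the arrangement, and let \<open>W\<close>
  be the winding number of this curve as a function on the faces. At a crossing \<open>v\<close> the vector
  \<open>\<Psi> (- \<Sum> W(F) e\<^sub>F)\<close> has the coefficient
  \<open>W(right of v) + W(left of v) - W(above v) - W(below v)\<close>. Winding numbers of adjacent faces differ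
  by the number of signed passages of \<open>p\<close> along the edge between them, so by Kirchhoff's law at
  \<open>v\<close> this is \<open>1\<close> or \<open>- 1\<close> for each change of lines at \<open>v\<close> and \<open>0\<close> for each straight passage, which
  is the coefficient of \<open>c\<^sub>p\<close> (\<open>winding_around_crossing\<close>).

  It remains to see that \<open>\<Sum> W(F) e\<^sub>F\<close> is the sum over the enclosed faces, that is, that \<open>W\<close> only
  takes the values \<open>0\<close> and \<open>1\<close> (\<open>path_winding_0_or_1\<close>). Through every point there is a barrier: a
  curve from left to right such that directed paths can cross it downwards but not upwards.
  Hence the pieces of \<open>p\<close> above the point, which determine \<open>W\<close>, belong to an initial part of \<open>p\<close> that
  ends where \<open>p\<close> crosses the barrier; such an initial part starts at the right end, and passes
  the slab of the point alternately to the left and to the right. Barriers exist since the word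
  is reduced: at a crossing, the line with the smaller number comes from below
  (\<open>reduced_crossing_order\<close>).

  Invertibility is clear from the shape of the matrix: the face to the right of a crossing has
  only this crossing and later ones as vertices, and \<open>F\<^sub>i\<close> is the only face whose image involves \<open>c\<^sub>i\<close>.\<close>

section \<open>Reduced words\<close>

lemma word_perm_Nil [simp]: "word_perm [] = id"
  and word_perm_Cons: "word_perm (i # us) = simple_refl i \<circ> word_perm us"
  by (simp_all add: word_perm_def)

lemma word_perm_append: "word_perm (us @ vs) = word_perm us \<circ> word_perm vs"
  by (induction us) (simp_all add: word_perm_Cons o_assoc)

lemma simple_refl_simple_refl [simp]: "simple_refl i (simple_refl i x) = x"
  by (simp add: simple_refl_def)

lemma word_perm_rev: "word_perm (rev us) (word_perm us x) = x"
  by (induction us arbitrary: x) (simp_all add: word_perm_Cons word_perm_append)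

lemma word_perm_rev': "word_perm us (word_perm (rev us) x) = x"
  using word_perm_rev[of "rev us"] by simp

lemma line_height_word_perm:
  "t \<le> length ws \<Longrightarrow> line_height ws t = word_perm (rev (take t ws))"
  by (induction t) (auto simp: fun_eq_iff take_Suc_conv_app_nth word_perm_append word_perm_Cons)

lemma inj_line_height: "inj (line_height ws t)"
proof (induction t)
  case (Suc t)
  show ?case
    by (rule injI) (metis Suc.IH injD line_height.simps(2) simple_refl_simple_refl)
qed (simp add: inj_def)

lemma line_height_eq_iff [simp]: "line_height ws t a = line_height ws t b \<longleftrightarrow> a = b"
  by (rule inj_eq[OF inj_line_height])

lemma surj_line_height: "\<exists>a. line_height ws t a = h"
proof (induction t arbitrary: h)
  case (Suc t)
  obtain a where "line_height ws t a = simple_refl (ws ! t) h" using Suc by blast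
  then show ?case by (intro exI[of _ a]) simp
qed simp

text \<open>Exchanging the names of two lines between two of their crossings shows that these two crossings
  can be removed together.\<close>

lemma word_perm_delete_double_crossing:
  assumes "k < j" and k: "lines_cross_at ws k a b" and j: "lines_cross_at ws j a b"
  obtains us where "set us \<subseteq> set ws" "word_perm us = word_perm ws" "length us < length ws"
proof -
  define B where "B = take (j - Suc k) (drop (Suc k) ws)"
  have len: "j < length ws" using j by (simp add: lines_cross_at_def)
  have take_j: "take j ws = take k ws @ ws ! k # B"
  proof -
    have "take j ws = take (Suc k) ws @ take (j - Suc k) (drop (Suc k) ws)"
      using \<open>k < j\<close> by (metis Suc_leI le_add_diff_inverse take_add)
    then show ?thesis
      using \<open>k < j\<close> len by (simp add: B_def take_Suc_conv_app_nth)
  qed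
  have split: "ws = take k ws @ ws ! k # B @ ws ! j # drop (Suc j) ws"
    by (subst id_take_nth_drop[OF len], subst take_j) simp
  let ?x = "ws ! k" and ?y = "ws ! j" and ?p = "word_perm B"
  have hj: "line_height ws j c = word_perm (rev B) (simple_refl ?x (line_height ws k c))" for c
    using len \<open>k < j\<close> take_j
    by (simp add: line_height_word_perm word_perm_append word_perm_Cons)
  have p: "?p (line_height ws j c) = simple_refl ?x (line_height ws k c)" for c
    by (simp add: hj word_perm_rev')
  have "{?p ?y, ?p (Suc ?y)} = ?p ` {line_height ws j a, line_height ws j b}"
    using j by (simp add: lines_cross_at_def)
  also have "\<dots> = simple_refl ?x ` {line_height ws k a, line_height ws k b}"
    by (simp add: p)
  also have "{line_height ws k a, line_height ws k b} = {?x, Suc ?x}"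
    using k by (simp only: lines_cross_at_def)
  also have "simple_refl ?x ` {?x, Suc ?x} = {?x, Suc ?x}"
    by (simp add: simple_refl_def insert_commute)
  finally have img: "{?p ?y, ?p (Suc ?y)} = {?x, Suc ?x}" .
  have inj: "?p c = ?p d \<longleftrightarrow> c = d" for c d
    by (rule inj_eq) (rule inj_on_inverseI, rule word_perm_rev)
  \<comment> \<open>The part between the two letters conjugates one of them into the other, so they cancel.\<close>
  have conj: "simple_refl ?x (?p (simple_refl ?y c)) = ?p c" for c
  proof -
    have "?p ?y = ?x \<and> ?p (Suc ?y) = Suc ?x \<or> ?p ?y = Suc ?x \<and> ?p (Suc ?y) = ?x"
      using img by (simp only: doubleton_eq_iff)
    then show ?thesis
      using inj[of c ?y] inj[of c "Suc ?y"]
      by (cases "c = ?y"; cases "c = Suc ?y")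
        (auto simp only: simple_refl_def Transposition.transpose_def split: if_splits)
  qed
  have "word_perm (take k ws @ B @ drop (Suc j) ws) = word_perm ws"
    by (subst (3) split) (simp add: word_perm_append word_perm_Cons fun_eq_iff conj)
  moreover have "set (take k ws @ B @ drop (Suc j) ws) \<subseteq> set ws"
    by (subst (3) split) auto
  moreover have "length (take k ws @ B @ drop (Suc j) ws) < length ws"
    by (subst (3) split) simp
  ultimately show thesis using that by blast
qed

text \<open>By the previous lemma a double crossing would shorten the word. So two lines cross at most once,
  and then in the order in which they start.\<close>

lemma reduced_crossing_order:
  assumes red: "reduced_expression n w ws" and len: "j < length ws"
    and a: "line_height ws j a = ws ! j" and b: "line_height ws j b = Suc (ws ! j)"
  shows "a < b"
proof (rule ccontr)
  assume "\<not> a < b"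
  moreover have "a \<noteq> b" using a b by auto
  ultimately have "line_height ws 0 b < line_height ws 0 a" by simp
  moreover have "\<not> line_height ws j b < line_height ws j a" using a b by simp
  ultimately obtain k where k: "k < j" "line_height ws k b < line_height ws k a"
      "\<not> line_height ws (Suc k) b < line_height ws (Suc k) a"
    using ex_least_nat_less[of "\<lambda>t. \<not> line_height ws t b < line_height ws t a" j] by auto
  have "line_height ws k b = ws ! k \<and> line_height ws k a = Suc (ws ! k)"
    using k(2,3) by (auto simp: simple_refl_def Transposition.transpose_def split: if_splits)
  then have "lines_cross_at ws k a b"
    using k(1) len by (auto simp: lines_cross_at_def)
  moreover have "lines_cross_at ws j a b"
    using a b len by (simp add: lines_cross_at_def)
  ultimately obtain us where us: "set us \<subseteq> set ws" "word_perm us = word_perm ws"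
      "length us < length ws"
    using word_perm_delete_double_crossing k(1) by metis
  then have "is_expression n w us"
    using red by (auto simp: reduced_expression_def is_expression_def)
  then have "perm_length n w \<le> length us"
    unfolding perm_length_def by (intro Least_le) auto
  with us(3) red show False by (simp add: reduced_expression_def)
qed

section \<open>Winding numbers of directed paths\<close>

text \<open>A position is a boundary of slabs: position \<open>s\<close> is the left boundary of slab \<open>s\<close>, so that crossing
  \<open>j\<close> is at position \<open>Suc j\<close>, and the right end is at position \<open>Suc (length ws)\<close>.\<close>

definition entry :: "nat \<Rightarrow> nat \<times> nat \<Rightarrow> nat" where
  "entry i x = (if fst x \<le> i then Suc (snd x) else snd x)"

definition exit :: "nat \<Rightarrow> nat \<times> nat \<Rightarrow> nat" where
  "exit i x = (if fst x \<le> i then snd x else Suc (snd x))"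

definition direction :: "nat \<Rightarrow> nat \<times> nat \<Rightarrow> int" where
  "direction i x = (if fst x \<le> i then 1 else - 1)"

definition height :: "nat list \<Rightarrow> nat \<times> nat \<Rightarrow> nat" where
  "height ws x = line_height ws (snd x) (fst x)"

lemma path_winding_alt:
  "path_winding ws i P r t =
     (\<Sum>x\<leftarrow>P. of_bool (snd x = t \<and> r < height ws x) * direction i x)"
  unfolding path_winding_def
  by (intro arg_cong[of _ _ sum_list] map_cong)
    (auto simp: direction_def height_def split: prod.splits)

lemma directed_stepE:
  assumes "directed_step ws i x y"
  obtains j where "j < length ws" "exit i x = Suc j" "entry i y = Suc j"
    "next_crossing i x = j" "fst x = fst y \<or> lines_cross_at ws j (fst x) (fst y)"
  using assms
  by (cases x; cases y)
    (auto simp: directed_step_def exit_def entry_def next_crossing_def split: if_splits)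

lemma sum_list_map_neutral:
  fixes f :: "'a \<Rightarrow> 'b :: monoid_add"
  shows "(\<And>x. x \<in> set xs \<Longrightarrow> f x = 0) \<Longrightarrow> sum_list (map f xs) = 0"
  by (induction xs) auto

text \<open>Regrouping of the two contributions of each member of a list by the gaps between neighbours: for
  a path, \<open>E\<close> is the contribution of the end of a piece and \<open>N\<close> that of its beginning.\<close>

lemma sum_list_telescope:
  fixes E N :: "'a \<Rightarrow> 'b :: ab_group_add"
  assumes "P \<noteq> []"
  shows "(\<Sum>x\<leftarrow>P. E x - N x) =
    (\<Sum>(x, y)\<leftarrow>zip P (tl P). E x - N y) + E (last P) - N (hd P)"
  using assms
proof (induction P rule: induct_list012)
  case (3 x y zs)
  then show ?case by (simp add: algebra_simps)
qed simp_all

lemma successively_zip: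
  "successively R P \<Longrightarrow> (x, y) \<in> set (zip P (tl P)) \<Longrightarrow> R x y"
  by (induction P rule: induct_list012) auto

lemma sum_list_directed_telescope:
  fixes E N :: "nat \<times> nat \<Rightarrow> int"
  assumes "P \<noteq> []" "successively (directed_step ws i) P"
    and "\<And>x y. directed_step ws i x y \<Longrightarrow> E x = N y"
  shows "(\<Sum>x\<leftarrow>P. E x - N x) = E (last P) - N (hd P)"
proof -
  have "(\<Sum>(x, y)\<leftarrow>zip P (tl P). E x - N y) = (\<Sum>(x, y)\<leftarrow>zip P (tl P). 0)"
    using assms(2,3) by (intro arg_cong[of _ _ sum_list] map_cong) (auto dest: successively_zip)
  then show ?thesis using sum_list_telescope[OF assms(1), of E N] by (simp add: case_prod_unfold)
qed

text \<open>A piece in slab \<open>t\<close> moves the path from one side of the slab to the other, so the signed number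
  of passages is determined by the sides on which the path begins and ends.\<close>

lemma signed_passages:
  assumes "P \<noteq> []" "successively (directed_step ws i) P"
  shows "(\<Sum>x\<leftarrow>P. of_bool (snd x = t) * direction i x) =
    of_bool (exit i (last P) \<le> t) - of_bool (entry i (hd P) \<le> t)"
proof -
  have "(\<Sum>x\<leftarrow>P. of_bool (snd x = t) * direction i x) =
      (\<Sum>x\<leftarrow>P. of_bool (exit i x \<le> t) - of_bool (entry i x \<le> t))"
    by (intro arg_cong[of _ _ sum_list] map_cong) (auto simp: entry_def exit_def direction_def)
  also have "\<dots> = of_bool (exit i (last P) \<le> t) - of_bool (entry i (hd P) \<le> t)"
    by (rule sum_list_directed_telescope[OF assms]) (auto elim!: directed_stepE)
  finally show ?thesis .
qed

text \<open>A GP-path seen as a curve: for winding numbers it matters that it is directed, and that it comes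
  in from the right end and goes back to it.\<close>

definition return_path :: "nat \<Rightarrow> nat list \<Rightarrow> nat \<Rightarrow> (nat \<times> nat) list \<Rightarrow> bool" where
  "return_path n ws i P \<longleftrightarrow> P \<noteq> [] \<and> successively (directed_step ws i) P \<and>
     (\<exists>p q. 1 \<le> p \<and> p \<le> i \<and> i < q \<and> q \<le> n \<and> hd P = (p, length ws) \<and> last P = (q, length ws))"

lemma gp_path_return_path: "(i, P) \<in> gp_paths n ws \<Longrightarrow> return_path n ws i P"
  unfolding gp_paths_def return_path_def
  by (auto simp: rigorous_step_def elim!: successively_mono)

lemma return_pathD:
  assumes "return_path n ws i P"
  shows "P \<noteq> []" "successively (directed_step ws i) P" "entry i (hd P) = Suc (length ws)"
    "exit i (last P) = Suc (length ws)"
  using assms by (auto simp: return_path_def entry_def exit_def)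

lemma successively_predecessor:
  assumes "successively R P" "x \<in> set P"
  shows "x = hd P \<or> (\<exists>y. R y x)" "x = last P \<or> (\<exists>y. R x y)"
proof -
  obtain us vs where P: "P = us @ x # vs" using assms(2) by (meson split_list)
  show "x = hd P \<or> (\<exists>y. R y x)"
    using assms(1) unfolding P by (cases us rule: rev_cases) (auto simp: successively_append_iff)
  show "x = last P \<or> (\<exists>y. R x y)"
    using assms(1) unfolding P by (cases vs) (auto simp: successively_append_iff)
qed

lemma successively_invariant:
  assumes "successively R P" "\<And>x y. R x y \<Longrightarrow> D x \<Longrightarrow> D y" "P \<noteq> [] \<Longrightarrow> D (hd P)" "x \<in> set P"
  shows "D x"
  using assms(1,3,4)
proof (induction P rule: induct_list012)
  case (3 y z zs)
  have "D y" using 3(4) by simp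
  moreover have "D z" using 3(3) assms(2)[OF _ \<open>D y\<close>] by simp
  ultimately show ?case using 3(2,3,5) by auto
qed auto

text \<open>A path that has reached the left end of the arrangement cannot leave it again, so a path back to
  the right end does not meet the leftmost slab.\<close>

lemma winding_left_end:
  assumes "return_path n ws i P"
  shows "path_winding ws i P r 0 = 0"
proof -
  note P = return_pathD[OF assms]
  have "snd x \<noteq> 0" if "x \<in> set P" for x
  proof -
    have "exit i x \<noteq> 0" "entry i x \<noteq> 0"
      using successively_predecessor[OF P(2) that] P(3,4) by (auto elim!: directed_stepE)
    then show ?thesis by (auto simp: exit_def entry_def split: if_splits)
  qed
  then show ?thesis
    unfolding path_winding_alt by (intro sum_list_map_neutral) auto
qed

text \<open>Kirchhoff's law at crossing \<open>t\<close>, restricted to the pieces with a property \<open>Q\<close>: the flow into the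
  crossing and out of it differ only by the steps that gain or lose this property.\<close>

lemma sum_list_at_crossing:
  assumes "return_path n ws i P" "t < length ws"
  shows "(\<Sum>x\<leftarrow>P. of_bool (snd x = Suc t \<and> Q x) * direction i x) -
      (\<Sum>x\<leftarrow>P. of_bool (snd x = t \<and> Q x) * direction i x) =
    (\<Sum>(x, y)\<leftarrow>zip P (tl P).
       if next_crossing i x = t then of_bool (Q x) - of_bool (Q y) else 0)"
proof -
  note P = return_pathD[OF assms(1)]
  let ?E = "\<lambda>x. of_bool (exit i x = Suc t \<and> Q x) :: int"
    and ?N = "\<lambda>x. of_bool (entry i x = Suc t \<and> Q x) :: int"
  have "(\<Sum>x\<leftarrow>P. of_bool (snd x = Suc t \<and> Q x) * direction i x) -
      (\<Sum>x\<leftarrow>P. of_bool (snd x = t \<and> Q x) * direction i x) = (\<Sum>x\<leftarrow>P. ?E x - ?N x)"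
    unfolding sum_list_subtractf[symmetric]
    by (intro arg_cong[of _ _ sum_list] map_cong) (auto simp: entry_def exit_def direction_def)
  also have "\<dots> = (\<Sum>(x, y)\<leftarrow>zip P (tl P). ?E x - ?N y)"
    using sum_list_telescope[OF P(1), of ?E ?N] P(3,4) assms(2) by simp
  also have "\<dots> = (\<Sum>(x, y)\<leftarrow>zip P (tl P).
       if next_crossing i x = t then of_bool (Q x) - of_bool (Q y) else 0)"
    by (intro arg_cong[of _ _ sum_list] map_cong)
      (auto dest!: successively_zip[OF P(2)] elim!: directed_stepE)
  finally show ?thesis .
qed

lemma simple_refl_less_iff: "r \<noteq> k \<Longrightarrow> r < simple_refl k h \<longleftrightarrow> r < h"
  by (auto simp: simple_refl_def Transposition.transpose_def)

text \<open>Slabs \<open>t\<close> and \<open>Suc t\<close> of strip \<open>r\<close> then belong to the same face: both lines that meet at crossing \<open>t\<close> are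
  above the strip, or both are below it.\<close>

lemma winding_Suc:
  assumes "return_path n ws i P" "t < length ws" "ws ! t \<noteq> r"
  shows "path_winding ws i P r (Suc t) = path_winding ws i P r t"
proof -
  note P = return_pathD[OF assms(1)]
  let ?Q = "\<lambda>x. r < line_height ws t (fst x)"
  have "path_winding ws i P r (Suc t) = (\<Sum>x\<leftarrow>P. of_bool (snd x = Suc t \<and> ?Q x) * direction i x)"
    unfolding path_winding_alt using assms(3)
    by (intro arg_cong[of _ _ sum_list] map_cong) (auto simp: height_def simple_refl_less_iff)
  moreover have "path_winding ws i P r t = (\<Sum>x\<leftarrow>P. of_bool (snd x = t \<and> ?Q x) * direction i x)"
    unfolding path_winding_alt
    by (intro arg_cong[of _ _ sum_list] map_cong) (auto simp: height_def)
  moreover have "(\<Sum>(x, y)\<leftarrow>zip P (tl P).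
       if next_crossing i x = t then of_bool (?Q x) - of_bool (?Q y) else 0) = (0::int)"
  proof (rule sum_list_map_neutral, clarify)
    fix a s b s' assume xy: "((a, s), (b, s')) \<in> set (zip P (tl P))"
    have "?Q (a, s) = ?Q (b, s')" if "next_crossing i (a, s) = t"
      using successively_zip[OF P(2) xy] assms(3) that
      by (auto elim!: directed_stepE simp: lines_cross_at_def doubleton_eq_iff)
    then show "(if next_crossing i (a, s) = t then of_bool (?Q (a, s)) - of_bool (?Q (b, s')) else 0)
        = (0::int)" by simp
  qed
  ultimately show ?thesis
    using sum_list_at_crossing[OF assms(1,2), of ?Q] by simp
qed

section \<open>Integer matrices and cones\<close>

lemma det_lower_triangular_neg:
  fixes A :: "int mat"
  assumes A: "A \<in> carrier_mat d d"
    and upper: "\<And>i j. i < j \<Longrightarrow> j < d \<Longrightarrow> A $$ (i, j) = 0"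
    and diag: "\<And>i. i < d \<Longrightarrow> A $$ (i, i) = - 1"
  shows "det A = (- 1) ^ d"
proof -
  have "det A = prod_list (diag_mat A)" using upper A by (rule det_lower_triangular)
  also have "\<dots> = (\<Prod>i = 0..<d. - 1)"
    using A diag by (simp add: prod_list_diag_prod)
  finally show ?thesis by simp
qed

lemma GL_int_I:
  assumes A: "A \<in> carrier_mat d d" and det: "det A * det A = 1"
  shows "A \<in> GL_int d"
proof -
  let ?B = "det A \<cdot>\<^sub>m adj_mat A"
  note adj = adj_mat[OF A]
  have "det A \<cdot>\<^sub>m (det A \<cdot>\<^sub>m 1\<^sub>m d) = 1\<^sub>m d"
    using det by (intro eq_matI) (auto simp: mult.assoc[symmetric])
  then have "A * ?B = 1\<^sub>m d" "?B * A = 1\<^sub>m d"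
    using adj(2,3) by (simp_all add: mult_smult_distrib[OF A adj(1)] mult_smult_assoc_mat[OF adj(1) A])
  then show ?thesis
    using A adj(1) unfolding GL_int_def invertible_mat_def inverts_mat_def square_mat.simps by auto
qed

text \<open>\<open>M\<close> acts on functionals, and its transpose on points.\<close>

definition transposed_map :: "int mat \<Rightarrow> real vec \<Rightarrow> real vec" where
  "transposed_map M x = transpose_mat (real_mat M) *\<^sub>v x"

lemma transposed_map_carrier:
  "M \<in> GL_int d \<Longrightarrow> x \<in> carrier_vec d \<Longrightarrow> transposed_map M x \<in> carrier_vec d"
  unfolding transposed_map_def GL_int_def by (intro mult_mat_vec_carrier[of _ d d]) auto

lemma scalar_prod_transposed_map:
  assumes "M \<in> GL_int d" "v \<in> carrier_vec d" "x \<in> carrier_vec d"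
  shows "v \<bullet> transposed_map M x = (real_mat M *\<^sub>v v) \<bullet> x"
proof -
  have M: "real_mat M \<in> carrier_mat d d" using assms(1) by (simp add: GL_int_def)
  have "v \<bullet> transposed_map M x = transposed_map M x \<bullet> v"
    using assms transposed_map_carrier by (intro comm_scalar_prod)
  also have "\<dots> = x \<bullet> (real_mat M *\<^sub>v v)"
    unfolding transposed_map_def using M assms(2,3) by (rule transpose_vec_mult_scalar)
  also have "\<dots> = (real_mat M *\<^sub>v v) \<bullet> x"
    using M assms(2,3) by (intro comm_scalar_prod mult_mat_vec_carrier)
  finally show ?thesis .
qed

lemma GL_int_inverse:
  assumes M: "M \<in> GL_int d"
  shows "\<exists>M'\<in>GL_int d. \<forall>x\<in>carrier_vec d.
    transposed_map M' (transposed_map M x) = x \<and> transposed_map M (transposed_map M' x) = x"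
proof -
  have Mc: "M \<in> carrier_mat d d" using M by (simp add: GL_int_def)
  obtain B where B: "M * B = 1\<^sub>m d" "B * M = 1\<^sub>m (dim_row B)"
    using M by (auto simp: GL_int_def invertible_mat_def inverts_mat_def)
  have "dim_col B = d" using arg_cong[OF B(1), of dim_col] by simp
  moreover have "dim_row B = d" using arg_cong[OF B(2), of dim_col] Mc by simp
  ultimately have Bc: "B \<in> carrier_mat d d" by auto
  have BM: "B * M = 1\<^sub>m d" using B(2) Bc by simp
  have "B \<in> GL_int d"
    using B(1) BM Bc Mc unfolding GL_int_def invertible_mat_def inverts_mat_def square_mat.simps
    by auto
  moreover have inv: "transposed_map K (transposed_map L x) = x"
    if K: "K \<in> carrier_mat d d" and L: "L \<in> carrier_mat d d" and LK: "L * K = 1\<^sub>m d"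
      and x: "x \<in> carrier_vec d" for K L x
  proof -
    have "transposed_map K (transposed_map L x) =
        (transpose_mat (real_mat K) * transpose_mat (real_mat L)) *\<^sub>v x"
      using K L x unfolding transposed_map_def by (intro assoc_mult_mat_vec[symmetric]) auto
    also have "transpose_mat (real_mat K) * transpose_mat (real_mat L) =
        transpose_mat (real_mat L * real_mat K)"
      using K L by (intro transpose_mult[symmetric]) auto
    also have "real_mat L * real_mat K = 1\<^sub>m d"
      by (simp add: of_int_hom.mat_hom_mult[OF L K, symmetric] LK of_int_hom.mat_hom_one)
    finally show ?thesis using x by simp
  qed
  ultimately show ?thesis using inv[OF Bc Mc B(1)] inv[OF Mc Bc BM] by blast
qed

lemma transposed_map_bij_betw:
  assumes M: "M \<in> GL_int d" and A: "A \<subseteq> carrier_vec d" and B: "B \<subseteq> carrier_vec d"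
    and iff: "\<And>x. x \<in> carrier_vec d \<Longrightarrow> transposed_map M x \<in> B \<longleftrightarrow> x \<in> A"
  shows "bij_betw (transposed_map M) A B"
proof -
  obtain M' where M': "M' \<in> GL_int d"
    and inv: "\<forall>x\<in>carrier_vec d.
      transposed_map M' (transposed_map M x) = x \<and> transposed_map M (transposed_map M' x) = x"
    using GL_int_inverse[OF M] by blast
  show ?thesis
  proof (rule bij_betw_byWitness[where f' = "transposed_map M'"])
    show "transposed_map M ` A \<subseteq> B" using iff A by blast
    have "transposed_map M' y \<in> A" if "y \<in> B" for y
      using iff[OF transposed_map_carrier[OF M', of y]] inv that B by auto
    then show "transposed_map M' ` B \<subseteq> A" by blast
  qed (use inv A B in blast)+
qed

lemma unimodularly_equivalentI:
  assumes M: "M \<in> GL_int d" and A: "A \<subseteq> carrier_vec d" and B: "B = transposed_map M ` A"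
  shows "unimodularly_equivalent d A B"
proof -
  have zero: "map_vec real_of_int (0\<^sub>v d) = 0\<^sub>v d" by auto
  have "transpose_mat (real_mat M) *\<^sub>v x + map_vec real_of_int (0\<^sub>v d) = transposed_map M x"
    if "x \<in> A" for x
    unfolding zero transposed_map_def[symmetric]
    using transposed_map_carrier[OF M, of x] that A by (intro right_zero_vec) blast
  then have "B = (\<lambda>x. transpose_mat (real_mat M) *\<^sub>v x + map_vec real_of_int (0\<^sub>v d)) ` A"
    unfolding B by (intro image_cong) simp_all
  then show ?thesis
    unfolding unimodularly_equivalent_def using M zero_carrier_vec[of d] by blast
qed

lemma unimodularly_equivalent_sym:
  assumes M: "M \<in> GL_int d" and A: "A \<subseteq> carrier_vec d" and B: "B = transposed_map M ` A"
  shows "unimodularly_equivalent d B A"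
proof -
  obtain M' where M': "M' \<in> GL_int d"
    and inv: "\<forall>x\<in>carrier_vec d. transposed_map M' (transposed_map M x) = x"
    using GL_int_inverse[OF M] by blast
  show ?thesis
  proof (rule unimodularly_equivalentI[OF M'])
    show "B \<subseteq> carrier_vec d" unfolding B using A transposed_map_carrier[OF M] by blast
    have "transposed_map M' ` B = (\<lambda>x. x) ` A"
      unfolding B image_image by (intro image_cong) (use inv A in auto)
    then show "A = transposed_map M' ` B" by simp
  qed
qed

section \<open>The arrangement of a reduced word\<close>

text \<open>Reducedness enters through the order of the two lines at each crossing.\<close>

locale simple_arrangement =
  fixes n :: nat and ws :: "nat list"
  assumes letters: "set ws \<subseteq> {1..n - 1}"
    and crossing_order: "\<And>j a b. j < length ws \<Longrightarrow> line_height ws j a = ws ! j \<Longrightarrow>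
      line_height ws j b = Suc (ws ! j) \<Longrightarrow> a < b"
begin

lemma letter: "j < length ws \<Longrightarrow> 1 \<le> ws ! j \<and> ws ! j < n"
  using letters nth_mem[of j ws] by fastforce

text \<open>A path that starts on one of the lines \<open>1, \<dots>, n\<close> stays on these lines, since the others
  have no crossings.\<close>

lemma height_range:
  assumes "return_path n ws i P" "x \<in> set P" "snd x \<le> length ws"
  shows "1 \<le> height ws x \<and> height ws x \<le> n"
proof -
  have range: "1 \<le> line_height ws t a \<and> line_height ws t a \<le> n \<longleftrightarrow> 1 \<le> a \<and> a \<le> n"
    if "t \<le> length ws" for t a
    using that
  proof (induction t)
    case (Suc t)
    then show ?case
      using letter[of t] by (auto simp: simple_refl_def Transposition.transpose_def)
  qed simp
  have "1 \<le> fst x \<and> fst x \<le> n"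
  proof (rule successively_invariant[of "directed_step ws i" P "\<lambda>x. 1 \<le> fst x \<and> fst x \<le> n"])
    fix x y assume "directed_step ws i x y" and x: "1 \<le> fst x \<and> fst x \<le> n"
    then obtain j where j: "j < length ws" "fst x = fst y \<or> lines_cross_at ws j (fst x) (fst y)"
      by (auto elim: directed_stepE)
    from j(2) show "1 \<le> fst y \<and> fst y \<le> n"
    proof
      assume "lines_cross_at ws j (fst x) (fst y)"
      then have "1 \<le> line_height ws j (fst y) \<and> line_height ws j (fst y) \<le> n"
        using letter[of j] by (auto simp: lines_cross_at_def doubleton_eq_iff)
      then show ?thesis using range[of j] j(1) by simp
    qed (use x in simp)
  qed (use assms in \<open>auto simp: return_path_def\<close>)
  with range[OF assms(3)] show ?thesis by (simp add: height_def)
qed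

lemma winding_above:
  assumes "return_path n ws i P" "t \<le> length ws"
  shows "path_winding ws i P n t = 0"
  unfolding path_winding_alt
  by (intro sum_list_map_neutral) (use height_range[OF assms(1)] assms(2) in fastforce)

text \<open>Below all lines every passage counts, and a closed curve passes a slab as often to the left as to
  the right.\<close>

lemma winding_below:
  assumes "return_path n ws i P" "t \<le> length ws"
  shows "path_winding ws i P 0 t = 0"
proof -
  have "path_winding ws i P 0 t = (\<Sum>x\<leftarrow>P. of_bool (snd x = t) * direction i x)"
    unfolding path_winding_alt
    by (intro arg_cong[of _ _ sum_list] map_cong refl)
      (use height_range[OF assms(1)] assms(2) in \<open>fastforce simp: of_bool_def\<close>)
  also have "\<dots> = 0"
    using signed_passages[OF return_pathD(1,2)[OF assms(1)]] return_pathD(3,4)[OF assms(1)] assms(2)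
    by simp
  finally show ?thesis .
qed

section \<open>Barriers and the values of winding numbers\<close>

text \<open>A barrier separates, in each slab \<open>s\<close>, the lines of height at most \<open>f s\<close> from the higher ones.
  The condition for heights \<open>u\<close> to the left and \<open>v\<close> to the right of crossing \<open>j\<close> is that no directed
  step through \<open>j\<close> leads from below the barrier to above it.\<close>

definition barrier_at :: "nat \<Rightarrow> nat \<Rightarrow> nat \<Rightarrow> nat \<Rightarrow> bool" where
  "barrier_at i j u v \<longleftrightarrow> (\<forall>a b. a = b \<or> lines_cross_at ws j a b \<longrightarrow>
     (if a \<le> i then line_height ws (Suc j) a \<le> v else line_height ws j a \<le> u) \<longrightarrow>
     (if b \<le> i then line_height ws j b \<le> u else line_height ws (Suc j) b \<le> v))"

lemma barrier_at_same:
  assumes "ws ! j \<noteq> u"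
  shows "barrier_at i j u u"
proof -
  have 1: "line_height ws (Suc j) a \<le> u \<longleftrightarrow> line_height ws j a \<le> u" for a
    using simple_refl_less_iff[of u "ws ! j"] assms by (simp flip: not_less)
  have 2: "line_height ws j a \<le> u \<longleftrightarrow> line_height ws j b \<le> u" if "lines_cross_at ws j a b" for a b
    using that assms by (auto simp: lines_cross_at_def doubleton_eq_iff)
  show ?thesis unfolding barrier_at_def 1 using 2 by auto
qed

lemma crossing_lines:
  assumes "j < length ws"
  obtains c d where "c < d"
    "\<And>a. line_height ws j a = ws ! j \<longleftrightarrow> a = c"
    "\<And>a. line_height ws j a = Suc (ws ! j) \<longleftrightarrow> a = d"
    "line_height ws (Suc j) c = Suc (ws ! j)" "line_height ws (Suc j) d = ws ! j"
    "\<And>a. a \<noteq> c \<Longrightarrow> a \<noteq> d \<Longrightarrow> line_height ws (Suc j) a = line_height ws j a"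
    "\<And>a b. lines_cross_at ws j a b \<longleftrightarrow> a = c \<and> b = d \<or> a = d \<and> b = c"
proof -
  obtain c d where c: "line_height ws j c = ws ! j" and d: "line_height ws j d = Suc (ws ! j)"
    using surj_line_height by meson
  have c': "line_height ws j a = ws ! j \<longleftrightarrow> a = c" for a
    using line_height_eq_iff[of ws j a c] c by simp
  have d': "line_height ws j a = Suc (ws ! j) \<longleftrightarrow> a = d" for a
    using line_height_eq_iff[of ws j a d] d by simp
  show thesis
  proof (rule that[of c d])
    show "line_height ws (Suc j) a = line_height ws j a" if "a \<noteq> c" "a \<noteq> d" for a
      using that c'[of a] d'[of a] by (simp add: simple_refl_def)
    show "lines_cross_at ws j a b \<longleftrightarrow> a = c \<and> b = d \<or> a = d \<and> b = c" for a b
      using assms by (simp add: lines_cross_at_def doubleton_eq_iff c' d')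
    show "line_height ws (Suc j) c = Suc (ws ! j)" using c by (simp add: simple_refl_def)
    show "line_height ws (Suc j) d = ws ! j" using d by (simp add: simple_refl_def)
  qed (rule crossing_order[OF assms c d] c' d')+
qed

text \<open>Only a barrier that enters the crossing itself needs care. The two lines \<open>c < d\<close> at the crossing
  are oriented in one of the three ways left-left, left-right, right-right for \<open>(c, d)\<close>. If both
  go to the left, the barrier leaves above the crossing, and otherwise below it. In the case
  right-left, which the order \<open>c < d\<close> excludes, it could do neither.\<close>

lemma barrier_leftwards:
  assumes "j < length ws"
  shows "\<exists>u. barrier_at i j u v"
proof (cases "ws ! j = v")
  case False
  then show ?thesis using barrier_at_same by blast
next
  case True
  obtain c d where cd: "c < d"
    and c: "\<And>a. line_height ws j a = v \<longleftrightarrow> a = c"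
    and d: "\<And>a. line_height ws j a = Suc v \<longleftrightarrow> a = d"
    and new: "line_height ws (Suc j) c = Suc v" "line_height ws (Suc j) d = v"
    and other: "\<And>a. a \<noteq> c \<Longrightarrow> a \<noteq> d \<Longrightarrow> line_height ws (Suc j) a = line_height ws j a"
    and cross: "\<And>a b. lines_cross_at ws j a b \<longleftrightarrow> a = c \<and> b = d \<or> a = d \<and> b = c"
    by (rule crossing_lines[OF assms, unfolded True]) (rule that; assumption)
  have old: "line_height ws j c = v" "line_height ws j d = Suc v" using c d by blast+
  have v: "0 < v" using letter[OF assms] True by simp
  \<comment> \<open>Line \<open>d\<close> goes to the left iff both lines do.\<close>
  let ?u = "if d \<le> i then Suc v else v - 1"
  have "barrier_at i j ?u v"
    unfolding barrier_at_def
  proof (intro allI impI)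
    fix a b assume step: "a = b \<or> lines_cross_at ws j a b"
      and below: "if a \<le> i then line_height ws (Suc j) a \<le> v else line_height ws j a \<le> ?u"
    show "if b \<le> i then line_height ws j b \<le> ?u else line_height ws (Suc j) b \<le> v"
    proof (cases "a = c \<or> a = d")
      case True
      then have "b = c \<or> b = d" using step cross[of a b] by auto
      then show ?thesis using True below cd new old v
        by (elim disjE) (simp_all del: line_height.simps split: if_splits)
    next
      case False
      then have "b = a" using step cross[of a b] by auto
      then show ?thesis using below False other[of a] c[of a] d[of a]
        by (auto simp del: line_height.simps split: if_splits)
    qed
  qed
  then show ?thesis by blast
qed

text \<open>The mirror image: the barrier leaves above the crossing if both lines go to the right, and below
  it otherwise.\<close>

lemma barrier_rightwards:
  assumes "j < length ws"
  shows "\<exists>v. barrier_at i j u v"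
proof (cases "ws ! j = u")
  case False
  then show ?thesis using barrier_at_same by blast
next
  case True
  obtain c d where cd: "c < d"
    and c: "\<And>a. line_height ws j a = u \<longleftrightarrow> a = c"
    and d: "\<And>a. line_height ws j a = Suc u \<longleftrightarrow> a = d"
    and new: "line_height ws (Suc j) c = Suc u" "line_height ws (Suc j) d = u"
    and other: "\<And>a. a \<noteq> c \<Longrightarrow> a \<noteq> d \<Longrightarrow> line_height ws (Suc j) a = line_height ws j a"
    and cross: "\<And>a b. lines_cross_at ws j a b \<longleftrightarrow> a = c \<and> b = d \<or> a = d \<and> b = c"
    by (rule crossing_lines[OF assms, unfolded True]) (rule that; assumption)
  have old: "line_height ws j c = u" "line_height ws j d = Suc u" using c d by blast+
  have u: "0 < u" using letter[OF assms] True by simp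
  \<comment> \<open>Line \<open>c\<close> goes to the right iff both lines do.\<close>
  let ?v = "if c \<le> i then u - 1 else Suc u"
  have "barrier_at i j u ?v"
    unfolding barrier_at_def
  proof (intro allI impI)
    fix a b assume step: "a = b \<or> lines_cross_at ws j a b"
      and below: "if a \<le> i then line_height ws (Suc j) a \<le> ?v else line_height ws j a \<le> u"
    show "if b \<le> i then line_height ws j b \<le> u else line_height ws (Suc j) b \<le> ?v"
    proof (cases "a = c \<or> a = d")
      case True
      then have "b = c \<or> b = d" using step cross[of a b] by auto
      then show ?thesis using True below cd new old u
        by (elim disjE) (simp_all del: line_height.simps split: if_splits)
    next
      case False
      then have "b = a" using step cross[of a b] by auto
      then show ?thesis using below False other[of a] c[of a] d[of a]
        by (auto simp del: line_height.simps split: if_splits)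
    qed
  qed
  then show ?thesis by blast
qed

text \<open>The barrier is continued crossing by crossing from slab \<open>t\<close> to both sides.\<close>

lemma barrier_exists:
  assumes "t \<le> length ws"
  shows "\<exists>f. f t = r \<and> (\<forall>j<length ws. barrier_at i j (f j) (f (Suc j)))"
proof -
  have "\<forall>j u. \<exists>v. j < length ws \<longrightarrow> barrier_at i j u v"
    using barrier_rightwards by blast
  then obtain right where right: "\<forall>j u. j < length ws \<longrightarrow> barrier_at i j u (right j u)"
    by (auto simp only: choice_iff)
  have "\<forall>j v. \<exists>u. j < length ws \<longrightarrow> barrier_at i j u v"
    using barrier_leftwards by blast
  then obtain left where left: "\<forall>j v. j < length ws \<longrightarrow> barrier_at i j (left j v) v"
    by (auto simp only: choice_iff)
  define up where "up = rec_nat r (\<lambda>k u. right (t + k) u)"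
  define down where "down = rec_nat r (\<lambda>k v. left (t - Suc k) v)"
  define f where "f s = (if t \<le> s then up (s - t) else down (t - s))" for s
  have "barrier_at i j (f j) (f (Suc j))" if j: "j < length ws" for j
  proof (cases "t \<le> j")
    case True
    then have "f (Suc j) = right j (f j)" by (simp add: f_def up_def Suc_diff_le)
    then show ?thesis using right j by simp
  next
    case False
    have "t - j = Suc (t - Suc j)" using False by simp
    then have "f j = left j (down (t - Suc j))" using False by (simp add: f_def down_def)
    moreover have "f (Suc j) = down (t - Suc j)"
      using False by (cases "t = Suc j") (simp_all add: f_def up_def down_def)
    ultimately show ?thesis using left j by simp
  qed
  moreover have "f t = r" by (simp add: f_def up_def)
  ultimately show ?thesis by blast
qed

lemma barrier_step:
  assumes f: "\<forall>j<length ws. barrier_at i j (f j) (f (Suc j))"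
    and step: "directed_step ws i x y" and x: "height ws x \<le> f (snd x)"
  shows "height ws y \<le> f (snd y)"
proof -
  obtain a s b t where xy: "x = (a, s)" "y = (b, t)" by fastforce
  obtain j where j: "j < length ws" "s = (if a \<le> i then Suc j else j)"
      "t = (if b \<le> i then j else Suc j)" "a = b \<or> lines_cross_at ws j a b"
    using step unfolding directed_step_def xy by auto
  have "(if a \<le> i then line_height ws (Suc j) a \<le> f (Suc j) else line_height ws j a \<le> f j) \<longrightarrow>
     (if b \<le> i then line_height ws j b \<le> f j else line_height ws (Suc j) b \<le> f (Suc j))"
    using f j(1,4) unfolding barrier_at_def by blast
  then show ?thesis
    using x j(2,3) by (simp add: xy height_def del: line_height.simps split: if_splits)
qed

text \<open>Take the barrier through strip \<open>r\<close> in slab \<open>t\<close>. Once the path is below it, it stays there. So the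
  pieces in slab \<open>t\<close> above the strip are the pieces in slab \<open>t\<close> of an initial part of the path, and their
  signed number is \<open>1\<close> or \<open>0\<close> according to the side of slab \<open>t\<close> on which this part ends.\<close>

lemma path_winding_0_or_1:
  assumes "return_path n ws i P" "t \<le> length ws"
  shows "path_winding ws i P r t \<in> {0, 1}"
proof -
  note P = return_pathD[OF assms(1)]
  obtain f where ft: "f t = r" and f: "\<forall>j<length ws. barrier_at i j (f j) (f (Suc j))"
    using barrier_exists[OF assms(2)] by blast
  let ?above = "\<lambda>x. f (snd x) < height ws x"
  define Q R where "Q = takeWhile ?above P" and "R = dropWhile ?above P"
  have PQR: "P = Q @ R" by (simp add: Q_def R_def)
  have Q: "?above x" if "x \<in> set Q" for x
    using that unfolding Q_def by (rule set_takeWhileD[THEN conjunct2])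
  have R: "\<not> ?above x" if "x \<in> set R" for x
  proof (rule successively_invariant[OF _ _ _ that, of "directed_step ws i"])
    show "successively (directed_step ws i) R"
      using P(2) unfolding PQR by (simp add: successively_append_iff)
    show "R \<noteq> [] \<Longrightarrow> \<not> ?above (hd R)" unfolding R_def by (rule hd_dropWhile)
    show "\<not> ?above y" if "directed_step ws i x y" "\<not> ?above x" for x y
      using barrier_step[OF f that(1)] that(2) by simp
  qed
  have "path_winding ws i P r t = (\<Sum>x\<leftarrow>Q. of_bool (snd x = t \<and> r < height ws x) * direction i x)
      + (\<Sum>x\<leftarrow>R. of_bool (snd x = t \<and> r < height ws x) * direction i x)"
    by (simp add: path_winding_alt PQR)
  also have "(\<Sum>x\<leftarrow>R. of_bool (snd x = t \<and> r < height ws x) * direction i x) = 0"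
    by (intro sum_list_map_neutral) (use R ft in fastforce)
  also have "(\<Sum>x\<leftarrow>Q. of_bool (snd x = t \<and> r < height ws x) * direction i x) =
      (\<Sum>x\<leftarrow>Q. of_bool (snd x = t) * direction i x)"
    by (intro arg_cong[of _ _ sum_list] map_cong refl)
      (use Q ft in \<open>fastforce simp: of_bool_def\<close>)
  finally have "path_winding ws i P r t = (\<Sum>x\<leftarrow>Q. of_bool (snd x = t) * direction i x)"
    by simp
  moreover have "(\<Sum>x\<leftarrow>Q. of_bool (snd x = t) * direction i x) \<in> {0, 1}"
  proof (cases "Q = []")
    case False
    then have "hd Q = hd P" by (simp add: PQR)
    moreover have "successively (directed_step ws i) Q"
      using P(2) unfolding PQR by (simp add: successively_append_iff)
    ultimately show ?thesis
      using signed_passages[of Q ws i t] False P(3) assms(2) by simp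
  qed simp
  ultimately show ?thesis by simp
qed

section \<open>Paths under the duality map\<close>

text \<open>Let \<open>c\<close> be the line that crosses from below to above. It separates the right face from the upper
  one, and the lower face from the left one. So the left-hand side is the difference between the
  signed passages along \<open>c\<close> after and before the crossing, to which only the changes between \<open>c\<close> and
  the other line contribute.\<close>

lemma winding_around_crossing:
  assumes "return_path n ws i P" and m: "m < length ws" and r: "r = ws ! m"
  shows "path_winding ws i P r (Suc m) + path_winding ws i P r m
      - path_winding ws i P (Suc r) m - path_winding ws i P (r - 1) m =
    (\<Sum>(x, y)\<leftarrow>zip P (tl P). if next_crossing i x = m \<and> fst x \<noteq> fst y
       then if fst x < fst y then 1 else - 1 else 0)"
proof -
  note P = return_pathD[OF assms(1)]
  obtain c d where cd: "c < d" and c: "\<And>a. line_height ws m a = r \<longleftrightarrow> a = c"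
    and "\<And>a. line_height ws m a = Suc r \<longleftrightarrow> a = d"
    and new: "line_height ws (Suc m) c = Suc r" and "line_height ws (Suc m) d = r"
    and "\<And>a. a \<noteq> c \<Longrightarrow> a \<noteq> d \<Longrightarrow> line_height ws (Suc m) a = line_height ws m a"
    and cross: "\<And>a b. lines_cross_at ws m a b \<longleftrightarrow> a = c \<and> b = d \<or> a = d \<and> b = c"
    by (rule crossing_lines[OF m, folded r]) (rule that; assumption)
  have c': "line_height ws (Suc m) a = Suc r \<longleftrightarrow> a = c" for a
    using new line_height_eq_iff[of ws "Suc m" a c] by (simp del: line_height.simps)
  have r0: "0 < r" using letter[OF m] r by simp
  have "path_winding ws i P r (Suc m) - path_winding ws i P (Suc r) (Suc m) =
      (\<Sum>x\<leftarrow>P. of_bool (snd x = Suc m \<and> fst x = c) * direction i x)"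
    unfolding path_winding_alt sum_list_subtractf[symmetric]
  proof (intro arg_cong[of _ _ sum_list] map_cong refl)
    fix x
    have "r < height ws x \<longleftrightarrow> Suc r < height ws x \<or> fst x = c" if "snd x = Suc m"
      using c'[of "fst x"] that by (auto simp: height_def simp del: line_height.simps)
    moreover have "\<not> Suc r < height ws x" if "snd x = Suc m" "fst x = c"
      using new that by (simp add: height_def)
    ultimately show "of_bool (snd x = Suc m \<and> r < height ws x) * direction i x
        - of_bool (snd x = Suc m \<and> Suc r < height ws x) * direction i x =
        of_bool (snd x = Suc m \<and> fst x = c) * direction i x"
      by (auto simp: of_bool_def)
  qed
  moreover have "path_winding ws i P (r - 1) m - path_winding ws i P r m =
      (\<Sum>x\<leftarrow>P. of_bool (snd x = m \<and> fst x = c) * direction i x)"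
    unfolding path_winding_alt sum_list_subtractf[symmetric]
  proof (intro arg_cong[of _ _ sum_list] map_cong refl)
    fix x
    have "r - 1 < height ws x \<longleftrightarrow> r < height ws x \<or> fst x = c" if "snd x = m"
      using c[of "fst x"] that r0 by (auto simp: height_def)
    moreover have "\<not> r < height ws x" if "snd x = m" "fst x = c"
      using c[of c] that by (simp add: height_def)
    ultimately show "of_bool (snd x = m \<and> r - 1 < height ws x) * direction i x
        - of_bool (snd x = m \<and> r < height ws x) * direction i x =
        of_bool (snd x = m \<and> fst x = c) * direction i x"
      by (auto simp: of_bool_def)
  qed
  moreover have "path_winding ws i P (Suc r) (Suc m) = path_winding ws i P (Suc r) m"
    using winding_Suc[OF assms(1) m] r by simp
  moreover have "(\<Sum>(x, y)\<leftarrow>zip P (tl P).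
       if next_crossing i x = m then of_bool (fst x = c) - of_bool (fst y = c) else 0) =
    (\<Sum>(x, y)\<leftarrow>zip P (tl P). if next_crossing i x = m \<and> fst x \<noteq> fst y
       then if fst x < fst y then 1 else - 1 else (0::int))"
  proof (intro arg_cong[of _ _ sum_list] map_cong refl, clarify)
    fix a s b s' assume xy: "((a, s), (b, s')) \<in> set (zip P (tl P))"
    have "a = b \<or> lines_cross_at ws m a b" if "next_crossing i (a, s) = m"
      using successively_zip[OF P(2) xy] that by (auto elim!: directed_stepE)
    then show "(if next_crossing i (a, s) = m
          then of_bool (fst (a, s) = c) - of_bool (fst (b, s') = c) else 0) =
        (if next_crossing i (a, s) = m \<and> fst (a, s) \<noteq> fst (b, s')
         then if fst (a, s) < fst (b, s') then 1 else - 1 else (0::int))"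
      unfolding cross using cd by auto
  qed
  ultimately show ?thesis
    using sum_list_at_crossing[OF assms(1) m, of "\<lambda>x. fst x = c"] by linarith
qed

lemma next_at_level:
  assumes "j < length ws"
  shows "j < next_at_level ws j" "next_at_level ws j \<le> length ws"
    "next_at_level ws j < length ws \<Longrightarrow> ws ! next_at_level ws j = ws ! j"
    "j < k \<Longrightarrow> k < next_at_level ws j \<Longrightarrow> ws ! k \<noteq> ws ! j"
proof -
  let ?P = "\<lambda>j'. j < j' \<and> (j' = length ws \<or> ws ! j' = ws ! j)"
  have "?P (length ws)" using assms by simp
  then have "?P (LEAST j'. ?P j')" and le: "(LEAST j'. ?P j') \<le> length ws"
    by (rule LeastI, rule Least_le)
  then show "j < next_at_level ws j" "next_at_level ws j \<le> length ws"
    "next_at_level ws j < length ws \<Longrightarrow> ws ! next_at_level ws j = ws ! j"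
    unfolding next_at_level_def by auto
  show "j < k \<Longrightarrow> k < next_at_level ws j \<Longrightarrow> ws ! k \<noteq> ws ! j"
    unfolding next_at_level_def using not_less_Least[of k ?P] by blast
qed

lemma finite_level_set [simp]: "finite (level_set ws i)"
  by (simp add: level_set_def)

lemma sum_unit_vec:
  assumes "finite S" "m < d"
  shows "(\<Sum>j\<in>S. unit_vec d j $ m) = (of_bool (m \<in> S) :: real)"
proof -
  have "(\<Sum>j\<in>S. unit_vec d j $ m) = (\<Sum>j\<in>S. if m = j then 1 else 0 :: real)"
    using assms(2) by (intro sum.cong) (auto simp: unit_vec_def)
  then show ?thesis using assms(1) by simp
qed

lemma psi_neg_face_crossing:
  assumes "f < length ws" "m < full_dim n ws"
  shows "psi_neg_face n ws f $ m =
    of_bool (m = f) + of_bool (m < length ws \<and> m = next_at_level ws f)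
    - of_bool (m < length ws \<and> (ws ! m = ws ! f - 1 \<or> ws ! m = ws ! f + 1) \<and>
        f < m \<and> m < next_at_level ws f)"
proof -
  have fin: "finite {j \<in> level_set ws (ws ! f - 1) \<union> level_set ws (ws ! f + 1).
      f < j \<and> j < next_at_level ws f}" by simp
  have "psi_neg_face n ws f $ m = unit_vec (full_dim n ws) f $ m
      + (if next_at_level ws f < length ws then unit_vec (full_dim n ws) (next_at_level ws f) $ m else 0)
      - (\<Sum>j\<in>{j \<in> level_set ws (ws ! f - 1) \<union> level_set ws (ws ! f + 1).
          f < j \<and> j < next_at_level ws f}. unit_vec (full_dim n ws) j $ m)"
    using assms by (simp add: psi_neg_face_def Let_def)
  then show ?thesis
    using assms unfolding sum_unit_vec[OF fin assms(2)]
    by (auto simp: unit_vec_def level_set_def of_bool_def)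
qed

definition face_winding :: "nat \<Rightarrow> (nat \<times> nat) list \<Rightarrow> nat \<Rightarrow> int" where
  "face_winding i P f = path_winding ws i P (face_strip ws f) (face_slab ws f)"

text \<open>At every slab \<open>t\<close>, a strip \<open>r\<close> meets exactly one face, and the winding number at this face
  can be read off at slab \<open>t\<close>; it is \<open>0\<close> for the face that is unbounded to the left.\<close>

lemma sum_faces_of_strip:
  assumes "return_path n ws i P" "t \<le> length ws"
  shows "(\<Sum>f<length ws. of_bool (ws ! f = r \<and> f < t \<and> t \<le> next_at_level ws f) * face_winding i P f)
    = path_winding ws i P r t"
  using assms(2)
proof (induction t)
  case 0
  then show ?case using winding_left_end[OF assms(1)] by simp
next
  case (Suc t)
  show ?case
  proof (cases "ws ! t = r")
    case True
    have "(\<Sum>f<length ws. of_bool (ws ! f = r \<and> f < Suc t \<and> Suc t \<le> next_at_level ws f) *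
        face_winding i P f) = (\<Sum>f<length ws. if f = t then face_winding i P f else 0)"
    proof (intro sum.cong refl)
      fix f assume "f \<in> {..<length ws}"
      then have f: "f < length ws" by simp
      have "ws ! f = r \<and> f < Suc t \<and> Suc t \<le> next_at_level ws f \<longleftrightarrow> f = t"
        using next_at_level(1)[OF f] next_at_level(4)[OF f, of t] True
        by (auto simp: less_Suc_eq_le Suc_le_eq le_less)
      then show "of_bool (ws ! f = r \<and> f < Suc t \<and> Suc t \<le> next_at_level ws f) *
          face_winding i P f = (if f = t then face_winding i P f else 0)" by auto
    qed
    also have "\<dots> = face_winding i P t" using Suc.prems by simp
    finally show ?thesis
      using True Suc.prems by (simp add: face_winding_def face_strip_def face_slab_def)
  next
    case False
    have "ws ! f = r \<and> f < Suc t \<and> Suc t \<le> next_at_level ws f \<longleftrightarrow>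
        ws ! f = r \<and> f < t \<and> t \<le> next_at_level ws f" if f: "f < length ws" for f
      using next_at_level(3)[OF f] Suc.prems False
      by (auto simp: less_Suc_eq Suc_le_eq le_less)
    then have "(\<Sum>f<length ws. of_bool (ws ! f = r \<and> f < Suc t \<and> Suc t \<le> next_at_level ws f) *
        face_winding i P f) =
      (\<Sum>f<length ws. of_bool (ws ! f = r \<and> f < t \<and> t \<le> next_at_level ws f) * face_winding i P f)"
      by (intro sum.cong) auto
    then show ?thesis
      using Suc.IH Suc.prems winding_Suc[OF assms(1) _ False] by simp
  qed
qed

text \<open>The coefficient of crossing \<open>m\<close> counts, with signs, whether the face \<open>f\<close> is to the right of,
  to the left of, above and below this crossing. In each of the four positions the face is
  described by its strip and a slab next to the crossing, as in \<open>sum_faces_of_strip\<close>.\<close>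

lemma psi_neg_face_split:
  assumes f: "f < length ws" and m: "m < length ws" and r: "r = ws ! m"
  shows "psi_neg_face n ws f $ m = of_int (
    of_bool (ws ! f = r \<and> f < Suc m \<and> Suc m \<le> next_at_level ws f)
    + of_bool (ws ! f = r \<and> f < m \<and> m \<le> next_at_level ws f)
    - of_bool (ws ! f = Suc r \<and> f < m \<and> m \<le> next_at_level ws f)
    - of_bool (ws ! f = r - 1 \<and> f < m \<and> m \<le> next_at_level ws f))"
proof -
  note nx = next_at_level(1)[OF f] next_at_level(3,4)[OF f]
  have strict: "m \<le> next_at_level ws f \<longleftrightarrow> m < next_at_level ws f" if "ws ! f \<noteq> r"
    using nx(2) that m r by (cases "m = next_at_level ws f") (simp_all add: le_less)
  have up: "ws ! f = Suc r \<longleftrightarrow> ws ! m = ws ! f - 1" and down: "ws ! f = r - 1 \<longleftrightarrow> ws ! m = ws ! f + 1"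
    and ne: "\<not> (ws ! m = ws ! f - 1 \<and> ws ! m = ws ! f + 1)" "r \<noteq> Suc r" "r \<noteq> r - 1"
    using letter[OF f] letter[OF m] r by linarith+
  have 1: "ws ! f = r \<and> f < Suc m \<and> Suc m \<le> next_at_level ws f \<longleftrightarrow> m = f"
    using nx(1) nx(3)[of m] r by (auto simp: less_Suc_eq_le Suc_le_eq le_less)
  have 2: "ws ! f = r \<and> f < m \<and> m \<le> next_at_level ws f \<longleftrightarrow> m = next_at_level ws f"
    using nx(1,2) nx(3)[of m] m r by (auto simp: le_less)
  have 3: "ws ! f = Suc r \<and> f < m \<and> m \<le> next_at_level ws f \<longleftrightarrow>
      ws ! m = ws ! f - 1 \<and> f < m \<and> m < next_at_level ws f"
    using strict ne(2) unfolding up[symmetric] by metis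
  have 4: "ws ! f = r - 1 \<and> f < m \<and> m \<le> next_at_level ws f \<longleftrightarrow>
      ws ! m = ws ! f + 1 \<and> f < m \<and> m < next_at_level ws f"
    using strict ne(3) unfolding down[symmetric] by metis
  have "m < full_dim n ws" using m by (simp add: full_dim_def)
  then show ?thesis
    unfolding 1 2 3 4 psi_neg_face_crossing[OF f \<open>m < full_dim n ws\<close>]
    using m ne(1) by (simp add: of_bool_def)
qed

lemma of_int_sum_list: "of_int (\<Sum>x\<leftarrow>xs. g x) = (\<Sum>x\<leftarrow>xs. of_int (g x) :: real)"
  by (induction xs) auto

lemma c_path_crossing:
  assumes "return_path n ws i P" "m < d"
  shows "c_path d i P $ m = of_int (\<Sum>(x, y)\<leftarrow>zip P (tl P). if next_crossing i x = m \<and> fst x \<noteq> fst y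
       then if fst x < fst y then 1 else - 1 else 0)"
  using assms(2) unfolding of_int_sum_list c_path_def
  by (simp, intro arg_cong[of _ _ sum_list] map_cong) (auto simp: unit_vec_def)

lemma c_path_beyond_crossings:
  assumes "return_path n ws i P" "m < d" "length ws \<le> m"
  shows "c_path d i P $ m = 0"
proof -
  have "next_crossing i x \<noteq> m" if "(x, y) \<in> set (zip P (tl P))" for x y
    using successively_zip[OF return_pathD(2)[OF assms(1)] that] assms(3)
    by (auto elim!: directed_stepE)
  then show ?thesis
    unfolding c_path_crossing[OF assms(1,2)] of_int_eq_0_iff
    by (intro sum_list_map_neutral) auto
qed

lemma face_winding_unbounded:
  assumes "return_path n ws i P" "length ws \<le> f"
  shows "face_winding i P f = 0"
  using winding_left_end[OF assms(1)] assms(2) by (simp add: face_winding_def face_slab_def)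

lemma e_path_face:
  assumes "return_path n ws i P" "m < d" "d \<le> full_dim n ws"
  shows "e_path d n ws i P $ m = - of_int (face_winding i P m)"
proof -
  have "enclosed_faces n ws i P \<subseteq> {..<full_dim n ws}" by (auto simp: enclosed_faces_def)
  then have "finite (enclosed_faces n ws i P)" using finite_subset by blast
  then have "e_path d n ws i P $ m = - of_bool (m \<in> enclosed_faces n ws i P)"
    using sum_unit_vec assms(2) by (simp add: e_path_def)
  moreover have "face_winding i P m \<in> {0, 1}"
    unfolding face_winding_def by (rule path_winding_0_or_1[OF assms(1)]) (simp add: face_slab_def)
  ultimately show ?thesis
    using assms(2,3) by (auto simp: enclosed_faces_def face_winding_def)
qed

lemma Psi_index:
  assumes "m < full_dim n ws"
  shows "Psi n ws x $ m = (\<Sum>f<full_dim n ws. - (x $ f) * psi_neg_face n ws f $ m)"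
proof -
  have "dim_vec (psi_neg_face n ws f) = full_dim n ws" for f
    by (simp add: psi_neg_face_def c_ineq_def Let_def)
  then show ?thesis using assms by (simp add: Psi_def)
qed

text \<open>As winding numbers are \<open>0\<close> or \<open>1\<close>, the coefficients of \<open>e\<^sub>p\<close> are the negated winding numbers; then
  the four neighbours of each crossing give the coefficients of \<open>c\<^sub>p\<close>.\<close>

lemma Psi_e_path:
  assumes P: "return_path n ws i P"
  shows "Psi n ws (e_path (full_dim n ws) n ws i P) = c_path (full_dim n ws) i P"
proof (rule eq_vecI)
  fix m assume "m < dim_vec (c_path (full_dim n ws) i P)"
  then have m: "m < full_dim n ws" by (simp add: c_path_def)
  have "Psi n ws (e_path (full_dim n ws) n ws i P) $ m =
      (\<Sum>f<full_dim n ws. of_int (face_winding i P f) * psi_neg_face n ws f $ m)"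
    unfolding Psi_index[OF m] by (intro sum.cong) (simp_all add: e_path_face[OF P])
  also have "\<dots> = (\<Sum>f<length ws. of_int (face_winding i P f) * psi_neg_face n ws f $ m)"
    by (rule sum.mono_neutral_right) (auto simp: full_dim_def face_winding_unbounded[OF P])
  also have "\<dots> = c_path (full_dim n ws) i P $ m"
  proof (cases "m < length ws")
    case True
    let ?s = "\<lambda>r t. \<Sum>f<length ws.
      of_bool (ws ! f = r \<and> f < t \<and> t \<le> next_at_level ws f) * face_winding i P f"
    have "(\<Sum>f<length ws. of_int (face_winding i P f) * psi_neg_face n ws f $ m) =
        of_int (?s (ws ! m) (Suc m) + ?s (ws ! m) m - ?s (Suc (ws ! m)) m - ?s (ws ! m - 1) m)"
      unfolding sum.distrib[symmetric] sum_subtractf[symmetric] of_int_sum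
      by (intro sum.cong refl) (simp add: psi_neg_face_split[OF _ True refl] algebra_simps)
    also have "\<dots> = of_int (path_winding ws i P (ws ! m) (Suc m) + path_winding ws i P (ws ! m) m
        - path_winding ws i P (Suc (ws ! m)) m - path_winding ws i P (ws ! m - 1) m)"
      using True by (simp only: sum_faces_of_strip[OF P less_imp_le] sum_faces_of_strip[OF P Suc_leI])
    also have "\<dots> = c_path (full_dim n ws) i P $ m"
      unfolding winding_around_crossing[OF P True refl] c_path_crossing[OF P m] ..
    finally show ?thesis .
  next
    case False
    then have "psi_neg_face n ws f $ m = 0" if "f < length ws" for f
      using psi_neg_face_crossing[OF that m] that by simp
    then show ?thesis using c_path_beyond_crossings[OF P m] False by simp
  qed
  finally show "Psi n ws (e_path (full_dim n ws) n ws i P) $ m = c_path (full_dim n ws) i P $ m" .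
qed (simp add: Psi_def c_path_def)

section \<open>Levels under the duality map\<close>

lemma level_list:
  "sorted_wrt (<) (level_list ws i)" "set (level_list ws i) = level_set ws i"
  "length (level_list ws i) = level_count ws i"
  by (simp_all add: level_list_def level_count_def)

lemma level_list_nth:
  assumes "k < level_count ws i"
  shows "level_list ws i ! k < length ws" "ws ! (level_list ws i ! k) = i"
  using nth_mem[of k "level_list ws i"] assms by (simp_all add: level_list level_set_def)

lemma level_list_less_iff:
  assumes "k < level_count ws i" "l < level_count ws i"
  shows "level_list ws i ! k < level_list ws i ! l \<longleftrightarrow> k < l"
  using assms level_list(1)[of i]
  by (metis level_list(3) linorder_less_linear not_less_iff_gr_or_eq sorted_wrt_nth_less)

lemma next_at_level_nth:
  assumes k: "k < level_count ws i"
  shows "next_at_level ws (level_list ws i ! k) =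
    (if Suc k < level_count ws i then level_list ws i ! Suc k else length ws)" (is "?nx = ?r")
proof -
  let ?j = "level_list ws i ! k"
  note j = level_list_nth[OF k]
  have r: "?j < ?r \<and> (?r = length ws \<or> ws ! ?r = i)"
    using j level_list_less_iff[of k i "Suc k"] level_list_nth[of "Suc k" i] by auto
  have "\<not> ?nx < ?r"
  proof
    assume less: "?nx < ?r"
    have "?r \<le> length ws" using level_list_nth(1)[of "Suc k" i] by (simp add: less_imp_le)
    with less have "?nx < length ws" by simp
    with next_at_level(3)[OF j(1)] j(2) have "?nx \<in> set (level_list ws i)"
      by (simp add: level_list level_set_def)
    then obtain l where l: "l < level_count ws i" "level_list ws i ! l = ?nx"
      unfolding in_set_conv_nth level_list(3) by blast
    then have "k < l" using next_at_level(1)[OF j(1)] level_list_less_iff[OF k l(1)] by simp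
    moreover have "l < Suc k" if "Suc k < level_count ws i"
      using less that level_list_less_iff[OF l(1) that] l(2) by simp
    ultimately show False using l(1) by linarith
  qed
  moreover have "\<not> ?r < ?nx"
    using next_at_level(4)[OF j(1), of ?r] next_at_level(2)[OF j(1)] r j(2) by auto
  ultimately show ?thesis by linarith
qed

lemma c_ineq_zero: "m < full_dim n ws \<Longrightarrow> c_ineq n ws i 0 $ m = of_bool (m = level_coord ws i)"
  by (simp add: c_ineq_def Let_def unit_vec_def)

lemma c_ineq_Suc:
  assumes "k < level_count ws i" "m < full_dim n ws" "j = level_list ws i ! k"
  shows "c_ineq n ws i (Suc k) $ m = of_bool (m = level_coord ws i) - of_bool (m = j)
    - 2 * of_bool (m < length ws \<and> ws ! m = i \<and> j < m)
    + of_bool (m < length ws \<and> (ws ! m = i - 1 \<or> ws ! m = i + 1) \<and> j < m)"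
proof -
  have fin: "finite {l \<in> level_set ws i. j < l}"
    "finite {l \<in> level_set ws (i - 1) \<union> level_set ws (i + 1). j < l}" by simp_all
  have "c_ineq n ws i (Suc k) $ m = unit_vec (full_dim n ws) (level_coord ws i) $ m
      - unit_vec (full_dim n ws) j $ m
      - 2 * (\<Sum>l\<in>{l \<in> level_set ws i. j < l}. unit_vec (full_dim n ws) l $ m)
      + (\<Sum>l\<in>{l \<in> level_set ws (i - 1) \<union> level_set ws (i + 1). j < l}.
          unit_vec (full_dim n ws) l $ m)"
    using assms(2,3) by (simp add: c_ineq_def Let_def)
  then show ?thesis
    unfolding sum_unit_vec[OF fin(1) assms(2)] sum_unit_vec[OF fin(2) assms(2)]
    using assms(2) by (auto simp: unit_vec_def level_set_def of_bool_def)
qed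

text \<open>Passing from one crossing of level \<open>i\<close> to the next, or beyond the last one, changes \<open>c\<^bsub>[i:k]\<^esub>\<close> by the
  crossings on the boundary of the face in between, with the signs of \<open>\<Psi>\<close>.\<close>

lemma c_ineq_step:
  assumes k: "k < level_count ws i" and m: "m < full_dim n ws"
  shows "c_ineq n ws i (Suc k) $ m + psi_neg_face n ws (level_list ws i ! k) $ m =
    c_ineq n ws i (if Suc k < level_count ws i then Suc (Suc k) else 0) $ m"
proof -
  let ?j = "level_list ws i ! k"
  note j = level_list_nth[OF k]
  note nx = next_at_level[OF j(1), unfolded j(2)]
  have i: "1 \<le> i" using letter[OF j(1)] j(2) by simp
  note psi = psi_neg_face_crossing[OF j(1) m, unfolded j(2)]
  have level: "ws ! m = i \<and> ?j < m \<longleftrightarrow> m = next_at_level ws ?j \<or>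
      ws ! m = i \<and> next_at_level ws ?j < m" if "m < length ws"
    using nx(1,3) nx(4)[of m] that by (cases m "next_at_level ws ?j" rule: linorder_cases) auto
  have neighbour: "(ws ! m = i - 1 \<or> ws ! m = i + 1) \<and> ?j < m \<longleftrightarrow>
      (ws ! m = i - 1 \<or> ws ! m = i + 1) \<and> ?j < m \<and> m < next_at_level ws ?j \<or>
      (ws ! m = i - 1 \<or> ws ! m = i + 1) \<and> next_at_level ws ?j < m" if "m < length ws"
    using nx(1,3) i that by (cases m "next_at_level ws ?j" rule: linorder_cases) auto
  show ?thesis
  proof (cases "Suc k < level_count ws i")
    case True
    then have nx_eq: "next_at_level ws ?j = level_list ws i ! Suc k"
      using next_at_level_nth[OF k] by simp
    show ?thesis
      using level neighbour True nx(1) level_list_nth(1)[OF True, folded nx_eq] unfolding psi c_ineq_Suc[OF k m refl]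
      by (cases "m < length ws")
        (auto simp: c_ineq_Suc[OF True m refl] nx_eq[symmetric] of_bool_def)
  next
    case False
    then have nx_eq: "next_at_level ws ?j = length ws"
      using next_at_level_nth[OF k] by simp
    show ?thesis
      using level neighbour False unfolding psi c_ineq_Suc[OF k m refl] nx_eq
      by (cases "m < length ws") (auto simp: c_ineq_zero[OF m] of_bool_def)
  qed
qed

lemma e_ineq_face:
  assumes "k \<le> level_count ws i" "m < full_dim n ws"
  shows "e_ineq n ws i k $ m =
    - of_bool (m = level_coord ws i) - of_bool (m \<in> set (take k (level_list ws i)))"
proof (cases k)
  case 0
  then show ?thesis using assms(2) by (simp add: e_ineq_def Let_def unit_vec_def)
next
  case (Suc l)
  have l: "l < level_count ws i" using assms(1) Suc by simp
  have fin: "finite {j \<in> level_set ws i. j \<le> level_list ws i ! l}" by simp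
  have "{j \<in> level_set ws i. j \<le> level_list ws i ! l} = set (take k (level_list ws i))"
  proof (intro equalityI subsetI)
    fix j assume j: "j \<in> {j \<in> level_set ws i. j \<le> level_list ws i ! l}"
    then have "j \<in> set (level_list ws i)" by (simp add: level_list(2))
    then obtain l' where l': "l' < level_count ws i" "level_list ws i ! l' = j"
      unfolding in_set_conv_nth level_list(3) by blast
    then have "l' < k" using level_list_less_iff[OF l l'(1)] Suc j by simp
    then show "j \<in> set (take k (level_list ws i))"
      using l' assms(1) by (auto simp: in_set_conv_nth level_list)
  next
    fix j assume "j \<in> set (take k (level_list ws i))"
    then obtain l' where l': "l' < k" "l' < level_count ws i" "j = level_list ws i ! l'"
      by (auto simp: in_set_conv_nth level_list)
    then have "\<not> level_list ws i ! l < j" using level_list_less_iff[OF l l'(2)] Suc by simp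
    moreover have "j \<in> level_set ws i"
      using nth_mem[of l' "level_list ws i"] l' by (simp add: level_list)
    ultimately show "j \<in> {j \<in> level_set ws i. j \<le> level_list ws i ! l}" by simp
  qed
  moreover have "e_ineq n ws i k $ m = - unit_vec (full_dim n ws) (level_coord ws i) $ m
      - (\<Sum>j\<in>{j \<in> level_set ws i. j \<le> level_list ws i ! l}. unit_vec (full_dim n ws) j $ m)"
    using assms(2) Suc by (simp add: e_ineq_def Let_def)
  ultimately show ?thesis
    using assms(2) unfolding sum_unit_vec[OF fin assms(2)] by (simp add: unit_vec_def)
qed

lemma psi_neg_face_partial_sum:
  assumes "i \<in> {1..n - 1}" "k \<le> level_count ws i" "m < full_dim n ws"
  shows "psi_neg_face n ws (level_coord ws i) $ m
      + (\<Sum>f\<in>set (take k (level_list ws i)). psi_neg_face n ws f $ m) =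
    c_ineq n ws i (if k < level_count ws i then Suc k else 0) $ m"
  using assms(2)
proof (induction k)
  case 0
  have "face_strip ws (level_coord ws i) = i" "\<not> level_coord ws i < length ws"
    using assms(1) by (auto simp: face_strip_def level_coord_def)
  then show ?case by (simp add: psi_neg_face_def)
next
  case (Suc k)
  then have k: "k < level_count ws i" by simp
  have "distinct (take (Suc k) (level_list ws i))"
    by (simp add: level_list_def)
  then have "level_list ws i ! k \<notin> set (take k (level_list ws i))"
    using k by (simp add: take_Suc_conv_app_nth level_list)
  then have "(\<Sum>f\<in>set (take (Suc k) (level_list ws i)). psi_neg_face n ws f $ m) =
      psi_neg_face n ws (level_list ws i ! k) $ m
      + (\<Sum>f\<in>set (take k (level_list ws i)). psi_neg_face n ws f $ m)"
    using k by (simp add: take_Suc_conv_app_nth level_list)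
  then show ?case using Suc.IH k c_ineq_step[OF k assms(3)] by simp
qed

lemma Psi_e_ineq:
  assumes i: "i \<in> {1..n - 1}" and k: "k \<le> level_count ws i"
  shows "Psi n ws (e_ineq n ws i k) =
    c_ineq n ws i (if k < level_count ws i then Suc k else 0)"
proof (rule eq_vecI)
  fix m assume "m < dim_vec (c_ineq n ws i (if k < level_count ws i then Suc k else 0))"
  then have m: "m < full_dim n ws" by (simp add: c_ineq_def Let_def split: if_splits)
  let ?S = "set (take k (level_list ws i))"
  have c: "level_coord ws i < full_dim n ws"
    using i by (auto simp: level_coord_def full_dim_def)
  have "?S \<subseteq> level_set ws i"
    unfolding level_list(2)[symmetric] by (rule set_take_subset)
  then have S: "{..<full_dim n ws} \<inter> ?S = ?S"
    by (auto simp: level_set_def full_dim_def)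
  have "Psi n ws (e_ineq n ws i k) $ m = (\<Sum>f<full_dim n ws.
      (if f = level_coord ws i then psi_neg_face n ws f $ m else 0)
      + (if f \<in> ?S then psi_neg_face n ws f $ m else 0))"
    unfolding Psi_index[OF m] by (intro sum.cong) (simp_all add: e_ineq_face[OF k])
  also have "\<dots> = psi_neg_face n ws (level_coord ws i) $ m + (\<Sum>f\<in>?S. psi_neg_face n ws f $ m)"
    using c by (simp add: sum.distrib sum.inter_restrict[symmetric] S)
  also have "\<dots> = c_ineq n ws i (if k < level_count ws i then Suc k else 0) $ m"
    by (rule psi_neg_face_partial_sum[OF i k m])
  finally show "Psi n ws (e_ineq n ws i k) $ m =
      c_ineq n ws i (if k < level_count ws i then Suc k else 0) $ m" .
qed (simp add: Psi_def c_ineq_def Let_def)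

section \<open>The duality matrix and the cones\<close>

definition duality_mat :: "nat \<Rightarrow> int mat" where
  "duality_mat d = mat d d (\<lambda>(m, f). \<lfloor>- psi_neg_face n ws f $ m\<rfloor>)"

lemma psi_neg_face_Ints:
  assumes "m < full_dim n ws"
  shows "psi_neg_face n ws f $ m \<in> \<int>"
  using assms
  by (auto simp: psi_neg_face_def Let_def c_ineq_def unit_vec_def
    intro!: Ints_add Ints_diff Ints_mult Ints_sum)

lemma duality_mat_carrier [simp]: "duality_mat d \<in> carrier_mat d d"
  by (simp add: duality_mat_def)

lemma duality_mat_entry:
  assumes "m < d" "f < d" "d \<le> full_dim n ws"
  shows "real_of_int (duality_mat d $$ (m, f)) = - psi_neg_face n ws f $ m"
proof -
  have "- psi_neg_face n ws f $ m \<in> \<int>" using psi_neg_face_Ints[of m f] assms by simp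
  then show ?thesis using assms by (simp add: duality_mat_def)
qed

lemma duality_mat_mult_index:
  assumes "x \<in> carrier_vec d" "m < d" "d \<le> full_dim n ws"
  shows "(real_mat (duality_mat d) *\<^sub>v x) $ m = (\<Sum>f<d. - (x $ f) * psi_neg_face n ws f $ m)"
proof -
  have "(real_mat (duality_mat d) *\<^sub>v x) $ m =
      (\<Sum>f<d. real_of_int (duality_mat d $$ (m, f)) * x $ f)"
    using assms(1,2) carrier_matD[OF duality_mat_carrier[of d]]
    by (simp add: scalar_prod_def atLeast0LessThan)
  also have "\<dots> = (\<Sum>f<d. - (x $ f) * psi_neg_face n ws f $ m)"
    using assms(2,3) by (intro sum.cong) (simp_all add: duality_mat_entry)
  finally show ?thesis .
qed

lemma Psi_duality_mat:
  assumes "x \<in> carrier_vec (full_dim n ws)"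
  shows "Psi n ws x = real_mat (duality_mat (full_dim n ws)) *\<^sub>v x"
proof (rule eq_vecI)
  fix m assume "m < dim_vec (real_mat (duality_mat (full_dim n ws)) *\<^sub>v x)"
  then have m: "m < full_dim n ws" by (simp add: duality_mat_def)
  show "Psi n ws x $ m = (real_mat (duality_mat (full_dim n ws)) *\<^sub>v x) $ m"
    unfolding Psi_index[OF m] duality_mat_mult_index[OF assms m order_refl] ..
qed (simp add: Psi_def duality_mat_def)

lemma psi_neg_face_outside:
  assumes "f < length ws" "length ws \<le> m" "m < full_dim n ws"
  shows "psi_neg_face n ws f $ m = 0"
  using psi_neg_face_crossing[OF assms(1,3)] assms by simp

lemma Psi_append_zero:
  assumes x: "x \<in> carrier_vec (length ws)"
  shows "Psi n ws (x @\<^sub>v 0\<^sub>v (n - 1)) =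
    (real_mat (duality_mat (length ws)) *\<^sub>v x) @\<^sub>v 0\<^sub>v (n - 1)"
proof (rule eq_vecI)
  fix m assume "m < dim_vec ((real_mat (duality_mat (length ws)) *\<^sub>v x) @\<^sub>v 0\<^sub>v (n - 1))"
  then have m: "m < full_dim n ws" by (simp add: duality_mat_def full_dim_def)
  let ?y = "x @\<^sub>v 0\<^sub>v (n - 1) :: real vec"
  have "Psi n ws ?y $ m = (\<Sum>f<length ws. - (?y $ f) * psi_neg_face n ws f $ m)"
    unfolding Psi_index[OF m] using x
    by (intro sum.mono_neutral_right) (auto simp: full_dim_def)
  also have "\<dots> = (\<Sum>f<length ws. - (x $ f) * psi_neg_face n ws f $ m)"
    using x by (intro sum.cong) auto
  also have "\<dots> = ((real_mat (duality_mat (length ws)) *\<^sub>v x) @\<^sub>v 0\<^sub>v (n - 1)) $ m"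
  proof (cases "m < length ws")
    case True
    then show ?thesis
      using duality_mat_mult_index[OF x True] by (simp add: full_dim_def duality_mat_def)
  next
    case False
    then show ?thesis
      using m psi_neg_face_outside[of _ m] by (simp add: full_dim_def duality_mat_def)
  qed
  finally show "Psi n ws ?y $ m =
      ((real_mat (duality_mat (length ws)) *\<^sub>v x) @\<^sub>v 0\<^sub>v (n - 1)) $ m" .
qed (use x in \<open>simp add: Psi_def duality_mat_def full_dim_def\<close>)

lemma psi_neg_face_unbounded:
  assumes "length ws \<le> f" "f < full_dim n ws" "length ws \<le> m" "m < full_dim n ws"
  shows "psi_neg_face n ws f $ m = of_bool (m = f)"
proof -
  let ?i = "face_strip ws f"
  have "level_coord ws ?i = f" using assms(1) by (simp add: level_coord_def face_strip_def)
  then have "c_ineq n ws ?i (if level_count ws ?i = 0 then 0 else 1) $ m = of_bool (m = f)"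
    using assms level_list_nth(1)[of 0 ?i] c_ineq_zero[OF assms(4), of ?i]
      c_ineq_Suc[of 0 ?i m, OF _ assms(4) refl]
    by (cases "level_count ws ?i = 0") auto
  then show ?thesis using assms(1) by (simp add: psi_neg_face_def Let_def)
qed

text \<open>The matrix is lower triangular because the leftmost vertex of a face that is bounded to the left
  is the crossing that bounds it there.\<close>

lemma det_duality_mat_crossings: "det (duality_mat (length ws)) = (- 1) ^ length ws"
proof (rule det_lower_triangular_neg)
  fix m f assume mf: "m < f" "f < length ws"
  have "psi_neg_face n ws f $ m = 0"
    using psi_neg_face_crossing[OF mf(2), of m] mf next_at_level(1)[OF mf(2)]
    by (simp add: full_dim_def)
  then show "duality_mat (length ws) $$ (m, f) = 0" using mf by (simp add: duality_mat_def)
next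
  fix f assume f: "f < length ws"
  have "psi_neg_face n ws f $ f = 1"
    using psi_neg_face_crossing[OF f, of f] f next_at_level(1)[OF f] by (simp add: full_dim_def)
  then show "duality_mat (length ws) $$ (f, f) = - 1"
    using f by (simp add: duality_mat_def floor_minus)
qed simp

text \<open>Among the coordinates \<open>c\<^sub>1, \<dots>, c\<^bsub>n-1\<^esub>\<close>, the face \<open>F\<^sub>i\<close> only involves \<open>c\<^sub>i\<close>, and the faces bounded to the
  left involve none.\<close>

lemma det_duality_mat_full:
  "det (duality_mat (full_dim n ws)) = (- 1) ^ length ws * (- 1) ^ (n - 1)"
proof -
  let ?l = "length ws" and ?D = "duality_mat (full_dim n ws)"
  define B where "B = mat ?l (n - 1) (\<lambda>(m, f). ?D $$ (m, f + ?l))"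
  define U where "U = mat (n - 1) (n - 1) (\<lambda>(m, f). if m = f then - 1 else 0 :: int)"
  have "?D = four_block_mat (duality_mat ?l) B (0\<^sub>m (n - 1) ?l) U"
  proof (rule eq_matI)
    fix m f
    assume "m < dim_row (four_block_mat (duality_mat ?l) B (0\<^sub>m (n - 1) ?l) U)"
      "f < dim_col (four_block_mat (duality_mat ?l) B (0\<^sub>m (n - 1) ?l) U)"
    then have m: "m < full_dim n ws" and f: "f < full_dim n ws"
      by (simp_all add: duality_mat_def U_def full_dim_def)
    show "?D $$ (m, f) = four_block_mat (duality_mat ?l) B (0\<^sub>m (n - 1) ?l) U $$ (m, f)"
      using m f psi_neg_face_outside[of f m] psi_neg_face_unbounded[of f m]
      by (auto simp: duality_mat_def B_def U_def full_dim_def not_less floor_minus)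
  qed (simp_all add: duality_mat_def U_def full_dim_def)
  also have "det \<dots> = det (duality_mat ?l) * det U"
    by (rule det_four_block_mat_lower_left_zero) (auto simp: B_def U_def)
  also have "det U = (- 1) ^ (n - 1)"
    by (rule det_lower_triangular_neg) (auto simp: U_def)
  finally show ?thesis by (simp add: det_duality_mat_crossings)
qed

lemma duality_mat_GL:
  "duality_mat (length ws) \<in> GL_int (length ws)"
  "duality_mat (full_dim n ws) \<in> GL_int (full_dim n ws)"
  by (intro GL_int_I;
    simp add: det_duality_mat_crossings det_duality_mat_full power_mult_distrib[symmetric]
      power_add[symmetric] mult_2[symmetric] mult.assoc mult.left_commute)+

lemma weighted_scalar_prod:
  assumes "v \<in> carrier_vec (full_dim n ws)" "x \<in> carrier_vec (full_dim n ws)"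
  shows "v \<bullet> transposed_map (duality_mat (full_dim n ws)) x = Psi n ws v \<bullet> x"
  using scalar_prod_transposed_map[OF duality_mat_GL(2) assms] Psi_duality_mat[OF assms(1)] by simp

lemma e_path_carrier: "e_path d n ws i P \<in> carrier_vec d"
  by (simp add: e_path_def)

lemma e_ineq_carrier: "e_ineq n ws i k \<in> carrier_vec (full_dim n ws)"
  by (simp add: e_ineq_def Let_def)

text \<open>The inequalities correspond one by one, the ones for the levels after a cyclic shift of \<open>k\<close>.\<close>

lemma weighted_cone_iff:
  assumes x: "x \<in> carrier_vec (full_dim n ws)"
  shows "transposed_map (duality_mat (full_dim n ws)) x \<in> weighted_area_cone n ws \<longleftrightarrow>
    x \<in> weighted_gp_cone n ws" (is "?T \<in> _ \<longleftrightarrow> _")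
proof -
  have T: "?T \<in> carrier_vec (full_dim n ws)"
    using transposed_map_carrier[OF duality_mat_GL(2) x] .
  have "e_path (full_dim n ws) n ws i P \<bullet> ?T = c_path (full_dim n ws) i P \<bullet> x"
    if "(i, P) \<in> gp_paths n ws" for i P
    using weighted_scalar_prod[OF e_path_carrier x] Psi_e_path[OF gp_path_return_path[OF that]]
    by simp
  then have paths: "(\<forall>(i, P)\<in>gp_paths n ws. 0 \<le> e_path (full_dim n ws) n ws i P \<bullet> ?T) \<longleftrightarrow>
      (\<forall>(i, P)\<in>gp_paths n ws. 0 \<le> c_path (full_dim n ws) i P \<bullet> x)"
    by (auto split: prod.splits)
  have levels: "(\<forall>k\<le>level_count ws i. 0 \<le> e_ineq n ws i k \<bullet> ?T) \<longleftrightarrow>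
      (\<forall>k\<le>level_count ws i. 0 \<le> c_ineq n ws i k \<bullet> x)" if i: "i \<in> {1..n - 1}" for i
  proof -
    have e: "e_ineq n ws i k \<bullet> ?T = c_ineq n ws i (if k < level_count ws i then Suc k else 0) \<bullet> x"
      if "k \<le> level_count ws i" for k
      using weighted_scalar_prod[OF e_ineq_carrier x] Psi_e_ineq[OF i that] by simp
    show ?thesis
    proof (intro iffI allI impI)
      fix k assume E: "\<forall>k\<le>level_count ws i. 0 \<le> e_ineq n ws i k \<bullet> ?T"
        and k: "k \<le> level_count ws i"
      show "0 \<le> c_ineq n ws i k \<bullet> x"
      proof (cases k)
        case 0
        then show ?thesis using E e[of "level_count ws i"] by auto
      next
        case (Suc l)
        then show ?thesis using E[rule_format, of l] e[of l] k by simp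
      qed
    next
      fix k assume "\<forall>k\<le>level_count ws i. 0 \<le> c_ineq n ws i k \<bullet> x" and "k \<le> level_count ws i"
      then show "0 \<le> e_ineq n ws i k \<bullet> ?T" using e[of k] by auto
    qed
  qed
  show ?thesis
    unfolding weighted_area_cone_def weighted_gp_cone_def using x T paths levels by auto
qed

lemma area_weight_transposed_map:
  assumes x: "x \<in> carrier_vec (full_dim n ws)"
  shows "area_weight n ws (transposed_map (duality_mat (full_dim n ws)) x) = gp_weight n ws x"
proof -
  have "e_ineq n ws (Suc r) (level_count ws (Suc r)) \<bullet> transposed_map (duality_mat (full_dim n ws)) x
      = unit_vec (full_dim n ws) (level_coord ws (Suc r)) \<bullet> x" if "r < n - 1" for r
    using that weighted_scalar_prod[OF e_ineq_carrier x]
      Psi_e_ineq[of "Suc r" "level_count ws (Suc r)"]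
    by (simp add: c_ineq_def Let_def)
  then show ?thesis unfolding area_weight_def gp_weight_def by (intro eq_vecI) simp_all
qed

text \<open>The unbounded faces are not enclosed, so the vectors \<open>e\<^sub>p\<close> and \<open>c\<^sub>p\<close> in both dimensions agree up to
  zeros.\<close>

lemma duality_mat_e_path:
  assumes P: "return_path n ws i P"
  shows "real_mat (duality_mat (length ws)) *\<^sub>v e_path (length ws) n ws i P = c_path (length ws) i P"
    (is "?N *\<^sub>v _ = _")
proof -
  let ?d = "full_dim n ws" and ?l = "length ws"
  have "e_path ?d n ws i P = e_path ?l n ws i P @\<^sub>v 0\<^sub>v (n - 1)"
  proof (rule eq_vecI)
    fix m assume "m < dim_vec (e_path ?l n ws i P @\<^sub>v 0\<^sub>v (n - 1))"
    then have "m < ?d" by (simp add: e_path_def full_dim_def)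
    then show "e_path ?d n ws i P $ m = (e_path ?l n ws i P @\<^sub>v 0\<^sub>v (n - 1)) $ m"
      using e_path_face[OF P, of m ?d] e_path_face[OF P, of m ?l] face_winding_unbounded[OF P, of m]
        e_path_carrier[of ?l i P]
      by (simp add: full_dim_def)
  qed (simp add: e_path_def full_dim_def)
  moreover have "c_path ?d i P = c_path ?l i P @\<^sub>v 0\<^sub>v (n - 1)"
  proof (rule eq_vecI)
    fix m assume "m < dim_vec (c_path ?l i P @\<^sub>v 0\<^sub>v (n - 1))"
    then have m: "m < ?d" by (simp add: c_path_def full_dim_def)
    have dim: "dim_vec (c_path ?l i P) = ?l" by (simp add: c_path_def)
    show "c_path ?d i P $ m = (c_path ?l i P @\<^sub>v 0\<^sub>v (n - 1)) $ m"
    proof (cases "m < ?l")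
      case True
      then show ?thesis
        using m dim c_path_crossing[OF P m] c_path_crossing[OF P True] by (simp add: full_dim_def)
    next
      case False
      then show ?thesis
        using m dim c_path_beyond_crossings[OF P m] by (simp add: full_dim_def)
    qed
  qed (simp add: c_path_def full_dim_def)
  ultimately have "(?N *\<^sub>v e_path ?l n ws i P) @\<^sub>v 0\<^sub>v (n - 1) = c_path ?l i P @\<^sub>v 0\<^sub>v (n - 1)"
    using Psi_e_path[OF P] Psi_append_zero[OF e_path_carrier[of ?l i P]] by simp
  moreover have "?N *\<^sub>v e_path ?l n ws i P \<in> carrier_vec ?l"
    by (intro mult_mat_vec_carrier[of _ ?l ?l] e_path_carrier) simp
  moreover have "c_path ?l i P \<in> carrier_vec ?l" by (simp add: c_path_def)
  ultimately show ?thesis by simp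
qed

lemma cone_iff:
  assumes x: "x \<in> carrier_vec (length ws)"
  shows "transposed_map (duality_mat (length ws)) x \<in> area_cone n ws \<longleftrightarrow> x \<in> gp_cone n ws"
    (is "?T \<in> _ \<longleftrightarrow> _")
proof -
  have T: "?T \<in> carrier_vec (length ws)"
    using transposed_map_carrier[OF duality_mat_GL(1) x] .
  have "e_path (length ws) n ws i P \<bullet> ?T = c_path (length ws) i P \<bullet> x"
    if "(i, P) \<in> gp_paths n ws" for i P
    using scalar_prod_transposed_map[OF duality_mat_GL(1) e_path_carrier x]
      duality_mat_e_path[OF gp_path_return_path[OF that]] by simp
  then show ?thesis
    unfolding area_cone_def gp_cone_def using x T by (auto split: prod.splits)
qed

end

section \<open>The unimodular equivalences\<close>

theorem theorem5:
  fixes n :: nat and w :: "nat \<Rightarrow> nat" and ws :: "nat list"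
  assumes "n \<ge> 1" and "w permutes {1..n}" and "reduced_expression n w ws"
  shows
    "unimodularly_equivalent (perm_length n w + (n - 1))
       (weighted_gp_cone n ws) (weighted_area_cone n ws) \<and>
     (\<exists>M\<in>GL_int (perm_length n w + (n - 1)).
        (\<forall>x\<in>carrier_vec (perm_length n w + (n - 1)). Psi n ws x = real_mat M *\<^sub>v x) \<and>
        bij_betw (\<lambda>x. transpose_mat (real_mat M) *\<^sub>v x)
          (weighted_gp_cone n ws) (weighted_area_cone n ws) \<and>
        (\<forall>lam\<in>carrier_vec (n - 1).
           bij_betw (\<lambda>x. transpose_mat (real_mat M) *\<^sub>v x)
             {x \<in> weighted_gp_cone n ws. gp_weight n ws x = lam}
             {x \<in> weighted_area_cone n ws. area_weight n ws x = lam})) \<and>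
     (\<exists>N\<in>GL_int (perm_length n w).
        (\<forall>x\<in>carrier_vec (perm_length n w).
           Psi n ws (x @\<^sub>v 0\<^sub>v (n - 1)) = (real_mat N *\<^sub>v x) @\<^sub>v 0\<^sub>v (n - 1)) \<and>
        bij_betw (\<lambda>x. transpose_mat (real_mat N) *\<^sub>v x) (gp_cone n ws) (area_cone n ws)) \<and>
     unimodularly_equivalent (perm_length n w) (area_cone n ws) (gp_cone n ws)"
proof -
  interpret simple_arrangement n ws
    using assms(3) reduced_crossing_order[OF assms(3)]
    by unfold_locales (auto simp: reduced_expression_def is_expression_def)
  let ?l = "length ws" and ?d = "full_dim n ws"
  let ?M = "duality_mat ?d" and ?N = "duality_mat ?l"
  have len: "perm_length n w = ?l" "?l + (n - 1) = ?d"
    using assms(3) by (simp_all add: reduced_expression_def full_dim_def)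
  have sub: "weighted_gp_cone n ws \<subseteq> carrier_vec ?d" "weighted_area_cone n ws \<subseteq> carrier_vec ?d"
    "gp_cone n ws \<subseteq> carrier_vec ?l" "area_cone n ws \<subseteq> carrier_vec ?l"
    by (auto simp: weighted_gp_cone_def weighted_area_cone_def gp_cone_def area_cone_def)
  have M: "bij_betw (transposed_map ?M) (weighted_gp_cone n ws) (weighted_area_cone n ws)"
    by (rule transposed_map_bij_betw[OF duality_mat_GL(2) sub(1,2) weighted_cone_iff])
  have slices: "bij_betw (transposed_map ?M) {x \<in> weighted_gp_cone n ws. gp_weight n ws x = lam}
      {x \<in> weighted_area_cone n ws. area_weight n ws x = lam}" for lam
    by (rule transposed_map_bij_betw[OF duality_mat_GL(2)])
      (use sub weighted_cone_iff area_weight_transposed_map in auto)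
  have N: "bij_betw (transposed_map ?N) (gp_cone n ws) (area_cone n ws)"
    by (rule transposed_map_bij_betw[OF duality_mat_GL(1) sub(3,4) cone_iff])
  have "unimodularly_equivalent ?d (weighted_gp_cone n ws) (weighted_area_cone n ws)"
    using unimodularly_equivalentI[OF duality_mat_GL(2) sub(1)] M by (simp add: bij_betw_def)
  moreover have "unimodularly_equivalent ?l (area_cone n ws) (gp_cone n ws)"
    using unimodularly_equivalent_sym[OF duality_mat_GL(1) sub(3)] N by (simp add: bij_betw_def)
  moreover have eta: "(\<lambda>x. transpose_mat (real_mat K) *\<^sub>v x) = transposed_map K" for K
    by (simp add: transposed_map_def fun_eq_iff)
  ultimately show ?thesis
    unfolding len eta
    using M N slices duality_mat_GL Psi_duality_mat Psi_append_zero by blast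
qed

end
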